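(* Let $l\ge 1$ and $e\ge 2$ be integers, let $\mathbf{s}\in\mathbb{Z}^l$ and let $\boldsymbol{\lambda}\vdash_l n$ be an $l$-partition. Then $(\boldsymbol{\lambda},\mathbf{s})$ is a $\mathcal{U}_q'(\widehat{\mathfrak{sl}_e})$-highest weight vertex (of the crystal $\mathcal{G}_{e,\mathbf{s}}$) if and only if $(\boldsymbol{\lambda},\mathbf{s})$ is totally periodic.
   Context: **Symbols.** A partition is a weakly decreasing finite sequence of nonnegative integers, extended by zeros. An $l$-partition is $\boldsymbol{\lambda}=(\lambda^0,\dots,\lambda^{l-1})$ with each $\lambda^c$ a partition; $\boldsymbol{\lambda}\vdash_l n$ means its total rank is $n$; $\boldsymbol{\emptyset}$ is the empty $l$-partition. For $\mathbf{s}=(s_0,\dots,s_{l-1})\in\mathbb{Z}^l$ (a multicharge), the symbol $\mathfrak{B}(\boldsymbol{\lambda},\mathbf{s})$ is the $l$-tuple of infinite strictly decreasing sequences $\mathfrak{B}(\boldsymbol{\lambda},\mathbf{s})^c_i=\lambda^c_i-i+s_c+1$, $i\ge 1$, $0\le c\le l-1$. It is drawn with $l$ rows, row $c=0$ at the bottom, row $l-1$ at the top, entries increasing from left to right. The pair $(\boldsymbol{\lambda},\mathbf{s})$ is determined by the symbol. **Periods.** $(\boldsymbol{\lambda},\mathbf{s})$ is $e$-periodic if there are pairs $(i_1,c_1),\dots,(i_e,c_e)$ and $k\in\mathbb{Z}$ with $\mathfrak{B}(\boldsymbol{\lambda},\mathbf{s})^{c_t}_{i_t}=k-t+1$ for $t=1,\dots,e$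 such that: (1) $c_1\ge c_2\ge\dots\ge c_e$; (2) $k$ is the largest entry of the symbol; (3) for each $t$, no entry equal to $k-t+1$ lies in a row $d<c_t$. These $e$ entries form the $e$-period. **Removing periods.** If $(\boldsymbol{\lambda},\mathbf{s})$ is not $e$-periodic put $(\boldsymbol{\lambda}^-,\mathbf{s}^-)=(\boldsymbol{\lambda},\mathbf{s})$. Otherwise, deleting the $e$-period from $\mathfrak{B}(\boldsymbol{\lambda},\mathbf{s})$ gives a symbol $\mathfrak{B}(\boldsymbol{\lambda}^-,\mathbf{s}^-)$, which defines $(\boldsymbol{\lambda}^-,\mathbf{s}^-)$. Let $\mathcal{T}_{l,e}=\{\mathbf{t}\in\mathbb{Z}^l\mid t_0\le\dots\le t_{l-1},\ t_{l-1}-t_0\le e-1\}$. **Peeling procedure.** If $(\boldsymbol{\lambda},\mathbf{s})$ is not $e$-periodic, or if $\boldsymbol{\lambda}=\boldsymbol{\emptyset}$ and $\mathbf{s}\in\mathcal{T}_{l,e}$, set $(\boldsymbol{\lambda}^\circ,\mathbf{s}^\circ)=(\boldsymbol{\lambda},\mathbf{s})$; otherwise set recursively $\boldsymbol{\lambda}^\circ=(\boldsymbol{\lambda}^-)^\circ$, $\mathbf{s}^\circ=(\mathbf{s}^-)^\circ$. (The procedure terminates.) The pair $(\boldsymbol{\lambda},\mathbf{s})$ is totally periodic when $\boldsymbol{\lambda}^\circ=\boldsymbol{\emptyset}$ and $\mathbf{s}^\circ\in\mathcal{T}_{l,e}$. **Crystal $\mathcal{G}_{e,\mathbf{s}}$.**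 A node $\gamma=(a,b,c)$ ($a,b\ge1$: row and column in $\lambda^c$) has content $b-a+s_c$, and residue its content mod $e$; an $i$-node is a node of residue $i\in\mathbb{Z}/e\mathbb{Z}$. Removable nodes of $\boldsymbol{\lambda}$ are nodes whose removal leaves an $l$-partition; addable nodes are nodes not in $\boldsymbol{\lambda}$ whose addition gives an $l$-partition. Order addable/removable $i$-nodes by $\gamma=(a,b,c)\prec_{\mathbf{s}}\gamma'=(a',b',c')$ iff the content of $\gamma$ is smaller than that of $\gamma'$, or the contents are equal and $c>c'$. Write the addable and removable $i$-nodes in increasing order, encode addable by $A$ and removable by $R$, and delete recursively all factors $RA$ to get $A^pR^q$. Set $\varphi_i(\boldsymbol{\lambda})=p$, $\varepsilon_i(\boldsymbol{\lambda})=q$. The node of the rightmost $A$ (if $p>0$) is the good addable $i$-node, the node of the leftmost $R$ (if $q>0$) is the good removable $i$-node. $\mathcal{G}_{e,\mathbf{s}}$ has all $l$-partitions as vertices and arrows $\boldsymbol{\lambda}\overset{i}{\to}\boldsymbol{\mu}$ when $\boldsymbol{\mu}$ is obtained from $\boldsymbol{\lambda}$ by adding its good addable $i$-node. $(\boldsymbol{\lambda},\mathbf{s})$ is a $\mathcal{U}_q'(\widehat{\mathfrak{sl}_e})$-highest weight vertex when $\varepsilon_i(\boldsymbol{\lambda})=0$ for all $i\in\mathbb{Z}/e\mathbb{Z}$. *)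

theory Defs
  imports Main "HOL-Library.While_Combinator"
begin

text \<open>
  All positions are counted from 0: \<open>p a\<close> is the part $\lambda_{a+1}$, the entry with index
  \<open>i\<close> of a row of a symbol is the entry number $i+1$, and the node \<open>(a, b, c)\<close> sits in row
  $a+1$ and column $b+1$ of the component $\lambda^c$. Contents do not change under this shift.
  An $l$-partition and a multicharge are lists of length $l$, component $c$ being \<open>lam ! c\<close>
  and \<open>s ! c\<close>.
\<close>

section \<open>Multipartitions and symbols\<close>

type_synonym mpart = "(nat \<Rightarrow> nat) list"

definition is_partition :: "(nat \<Rightarrow> nat) \<Rightarrow> bool" where
  "is_partition p \<longleftrightarrow> antimono p \<and> finite {a. p a \<noteq> 0}"

definition is_mpart :: "nat \<Rightarrow> mpart \<Rightarrow> bool" where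
  "is_mpart l lam \<longleftrightarrow> length lam = l \<and> (\<forall>c<l. is_partition (lam ! c))"

definition rank :: "mpart \<Rightarrow> nat" where
  "rank lam = (\<Sum>c<length lam. \<Sum>a | (lam ! c) a \<noteq> 0. (lam ! c) a)"

definition mpart_of :: "nat \<Rightarrow> nat \<Rightarrow> mpart \<Rightarrow> bool" where
  "mpart_of l n lam \<longleftrightarrow> is_mpart l lam \<and> rank lam = n"

definition empty_mpart :: "nat \<Rightarrow> mpart" where
  "empty_mpart l = replicate l (\<lambda>_. 0)"

definition symb :: "mpart \<Rightarrow> int list \<Rightarrow> nat \<Rightarrow> nat \<Rightarrow> int" where
  "symb lam s c i = int ((lam ! c) i) - int i + s ! c"


section \<open>Periods and the peeling procedure\<close>

text \<open>\<open>ps ! t\<close> is the pair $(i_{t+1}, c_{t+1})$.\<close>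

definition is_period :: "nat \<Rightarrow> nat \<Rightarrow> mpart \<Rightarrow> int list \<Rightarrow> int \<Rightarrow> (nat \<times> nat) list \<Rightarrow> bool" where
  "is_period l e lam s k ps \<longleftrightarrow>
     length ps = e \<and>
     (\<forall>t<e. snd (ps ! t) < l) \<and>
     (\<forall>t<e. symb lam s (snd (ps ! t)) (fst (ps ! t)) = k - int t) \<and>
     sorted_wrt (\<ge>) (map snd ps) \<and>
     (\<exists>c<l. \<exists>i. symb lam s c i = k) \<and> (\<forall>c<l. \<forall>i. symb lam s c i \<le> k) \<and>
     (\<forall>t<e. \<forall>d<snd (ps ! t). \<forall>i. symb lam s d i \<noteq> k - int t)"

definition e_periodic :: "nat \<Rightarrow> nat \<Rightarrow> mpart \<times> int list \<Rightarrow> bool" where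
  "e_periodic l e = (\<lambda>(lam, s). \<exists>k ps. is_period l e lam s k ps)"

text \<open>
  The rows of a symbol are strictly decreasing, so a row is determined by its set of entries,
  and the symbol obtained by deleting the period determines the pair \<open>(mu, t)\<close> uniquely.
\<close>

definition remove_period :: "nat \<Rightarrow> nat \<Rightarrow> mpart \<times> int list \<Rightarrow> mpart \<times> int list" where
  "remove_period l e = (\<lambda>(lam, s).
     if e_periodic l e (lam, s) then
       (THE (mu, t). is_mpart l mu \<and> length t = l \<and>
          (\<exists>k ps. is_period l e lam s k ps \<and>
             (\<forall>c<l. range (symb mu t c) = symb lam s c ` {i. (i, c) \<notin> set ps})))
     else (lam, s))"

definition T_set :: "nat \<Rightarrow> nat \<Rightarrow> int list set" where
  "T_set l e = {t. length t = l \<and> sorted t \<and> t ! (l - 1) - t ! 0 \<le> int e - 1}"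

definition is_trivial :: "nat \<Rightarrow> nat \<Rightarrow> mpart \<times> int list \<Rightarrow> bool" where
  "is_trivial l e = (\<lambda>(lam, s). lam = empty_mpart l \<and> s \<in> T_set l e)"

text \<open>
  \<open>Some (mu, t)\<close> is the result $(\lambda^\circ, s^\circ)$ of the procedure; \<open>None\<close>
  would mean that the procedure does not terminate.
\<close>

definition peel :: "nat \<Rightarrow> nat \<Rightarrow> mpart \<times> int list \<Rightarrow> (mpart \<times> int list) option" where
  "peel l e = while_option (\<lambda>x. e_periodic l e x \<and> \<not> is_trivial l e x) (remove_period l e)"

definition totally_periodic :: "nat \<Rightarrow> nat \<Rightarrow> mpart \<Rightarrow> int list \<Rightarrow> bool" where
  "totally_periodic l e lam s \<longleftrightarrow> (\<exists>x. peel l e (lam, s) = Some x \<and> is_trivial l e x)"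


section \<open>Highest weight vertices of the crystal\<close>

type_synonym node = "nat \<times> nat \<times> nat"

definition diagram :: "mpart \<Rightarrow> node set" where
  "diagram lam = {(a, b, c). c < length lam \<and> b < (lam ! c) a}"

definition addable :: "nat \<Rightarrow> mpart \<Rightarrow> node \<Rightarrow> bool" where
  "addable l lam x \<longleftrightarrow>
     x \<notin> diagram lam \<and> (\<exists>mu. is_mpart l mu \<and> diagram mu = insert x (diagram lam))"

definition removable :: "nat \<Rightarrow> mpart \<Rightarrow> node \<Rightarrow> bool" where
  "removable l lam x \<longleftrightarrow>
     x \<in> diagram lam \<and> (\<exists>mu. is_mpart l mu \<and> diagram mu = diagram lam - {x})"

fun content :: "int list \<Rightarrow> node \<Rightarrow> int" where
  "content s (a, b, c) = int b - int a + s ! c"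

text \<open>Residues are represented by the integers from \<open>0\<close> to \<open>e - 1\<close>.\<close>

definition residue :: "nat \<Rightarrow> int list \<Rightarrow> node \<Rightarrow> int" where
  "residue e s x = content s x mod int e"

definition node_less :: "int list \<Rightarrow> node \<Rightarrow> node \<Rightarrow> bool" where
  "node_less s x y \<longleftrightarrow>
     content s x < content s y \<or> (content s x = content s y \<and> snd (snd x) > snd (snd y))"

datatype letter = LetA | LetR

text \<open>
  On the finite set of addable and removable \<open>i\<close>-nodes the relation \<open>node_less s\<close> is a strict
  total order, so the increasing enumeration exists and is unique.
\<close>

definition i_nodes :: "nat \<Rightarrow> nat \<Rightarrow> int list \<Rightarrow> mpart \<Rightarrow> int \<Rightarrow> node list" where
  "i_nodes l e s lam i =
     (THE xs. set xs = {x. (addable l lam x \<or> removable l lam x) \<and> residue e s x = i} \<and>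
              sorted_wrt (node_less s) xs)"

definition i_word :: "nat \<Rightarrow> nat \<Rightarrow> int list \<Rightarrow> mpart \<Rightarrow> int \<Rightarrow> letter list" where
  "i_word l e s lam i = map (\<lambda>x. if addable l lam x then LetA else LetR) (i_nodes l e s lam i)"

inductive delete_RA :: "letter list \<Rightarrow> letter list \<Rightarrow> bool" where
  "delete_RA (u @ [LetR, LetA] @ v) (u @ v)"

text \<open>Every word reduces to a unique word of the form $A^p R^q$.\<close>

definition epsilon :: "nat \<Rightarrow> nat \<Rightarrow> int list \<Rightarrow> mpart \<Rightarrow> int \<Rightarrow> nat" where
  "epsilon l e s lam i =
     (THE q. \<exists>p. delete_RA\<^sup>*\<^sup>* (i_word l e s lam i) (replicate p LetA @ replicate q LetR))"

definition highest_weight_vertex :: "nat \<Rightarrow> nat \<Rightarrow> int list \<Rightarrow> mpart \<Rightarrow> bool" where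
  "highest_weight_vertex l e s lam \<longleftrightarrow> (\<forall>i\<in>{0..<int e}. epsilon l e s lam i = 0)"

end

theory Submission
  imports Defs
begin

text \<open>
  A symbol is the set \<open>B\<close> of its entries \<open>(x, c)\<close> (bead \<open>x\<close> in row \<open>c\<close>). Both sides of the
  equivalence are read off the numbers \<open>count e B x c\<close> of beads \<open>(y, d)\<close> with \<open>y\<close> congruent to \<open>x\<close>
  modulo \<open>e\<close> and either \<open>y > x\<close>, or \<open>y = x\<close> and \<open>d < c\<close>. The condition that decides everything is
  that \<open>count e B (x + 1) c \<le> count e B x c\<close> for all \<open>x\<close> and \<open>c\<close> (\<open>decreasing_counts\<close>).

  \<^emph>\<open>Highest weight.\<close> A node of content \<open>x\<close> in component \<open>c\<close> is addable when \<open>(x, c)\<close> is a bead and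
  \<open>(x + 1, c)\<close> is not, and removable when it is the other way round. The order of the nodes is
  that of the places \<open>(x, c)\<close> used in the counts, so the number of letters \<open>A\<close> minus the number of letters
  \<open>R\<close> in a suffix of the word is a difference \<open>count e B x c - count e B (x + 1) c\<close>. No \<open>R\<close> survives
  the cancellation exactly when every suffix contains at least as many \<open>A\<close> as \<open>R\<close>; hence highest
  weight means decreasing counts (\<open>highest_weight_vertex_iff\<close>).

  \<^emph>\<open>Periods.\<close> A period has one bead in each residue class, and that bead comes first among the beads
  of its class. Deleting the period therefore lowers every positive count by one and leaves the zero
  counts unchanged (\<open>count_remove_period\<close>). Moreover positivity of the counts is itself inherited
  from \<open>x + 1\<close> to \<open>x\<close> as soon as a period exists, so the deletion neither creates nor destroys
  decreasing counts (\<open>decreasing_counts_remove_period\<close>). Conversely, decreasing counts below the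
  largest bead say precisely that the lowest beads with the \<open>e\<close> largest values form a period
  (\<open>decreasing_counts_imp_bead_period\<close>).

  \<^emph>\<open>Conclusion.\<close> A trivial symbol has decreasing counts, so a totally periodic one has, going back
  along the peeling. If the counts decrease, peeling never gets stuck, and \<open>m\<close> deletions truncate
  the counts by \<open>m\<close>. For \<open>z\<close> in the part where all rows are full, \<open>m = count e B z l\<close> deletions
  leave exactly the beads with \<open>count e B x (c + 1) > m\<close>, and monotonicity of the counts makes this
  symbol trivial (\<open>is_trivial_of_truncated_counts\<close>).
\<close>

section \<open>Charged partitions and their bead sets\<close>

definition charged :: "(nat \<Rightarrow> nat) \<Rightarrow> int \<Rightarrow> nat \<Rightarrow> int" where
  "charged p t i = int (p i) - int i + t"

lemma symb_charged: "symb lam s c = charged (lam ! c) (s ! c)"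
  by (auto simp: symb_def charged_def)

lemma charged_strict_antimono:
  assumes "is_partition p" "i < j"
  shows "charged p t j < charged p t i"
proof -
  have "p j \<le> p i" using assms by (auto simp: is_partition_def antimono_def)
  then show ?thesis using assms(2) by (simp add: charged_def)
qed

lemma charged_eq_iff:
  assumes "is_partition p"
  shows "charged p t i = charged p t j \<longleftrightarrow> i = j"
  using charged_strict_antimono[OF assms, of i j t] charged_strict_antimono[OF assms, of j i t]
  by (cases i j rule: linorder_cases) auto

text \<open>
  Induction on the index: the value \<open>f n\<close> occurs in \<open>g\<close>, but not before place \<open>n\<close>, where \<open>g\<close> agrees with
  the injective \<open>f\<close>; so \<open>f n \<le> g n\<close>, and the converse holds by symmetry.
\<close>
lemma strictly_decreasing_range_unique:
  fixes f g :: "nat \<Rightarrow> int"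
  assumes f: "\<And>i j. i < j \<Longrightarrow> f j < f i" and g: "\<And>i j. i < j \<Longrightarrow> g j < g i"
    and r: "range f = range g"
  shows "f = g"
proof
  fix n show "f n = g n"
  proof (induction n rule: less_induct)
    case (less n)
    obtain m where m: "f n = g m" using r by (metis rangeE rangeI)
    obtain m' where m': "g n = f m'" using r by (metis rangeE rangeI)
    have "\<not> m < n" using less[of m] f[of m n] m by auto
    then have 1: "f n \<le> g n" using g[of n m] m by (cases "m = n") auto
    have "\<not> m' < n" using less[of m'] g[of m' n] m' by auto
    then have "g n \<le> f n" using f[of n m'] m' by (cases "m' = n") auto
    with 1 show ?case by simp
  qed
qed

text \<open>
  The charge is recovered from the tail of the sequence, where both partitions have no parts left.
\<close>
lemma charged_range_unique:
  assumes p: "is_partition p" and q: "is_partition q"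
    and r: "range (charged p t) = range (charged q u)"
  shows "p = q \<and> t = u"
proof -
  have eq: "charged p t = charged q u"
    using charged_strict_antimono[OF p] charged_strict_antimono[OF q] r
    by (intro strictly_decreasing_range_unique) auto
  have "finite ({a. p a \<noteq> 0} \<union> {a. q a \<noteq> 0})" using p q by (auto simp: is_partition_def)
  then obtain a where "a \<notin> {a. p a \<noteq> 0} \<union> {a. q a \<noteq> 0}"
    using ex_new_if_finite[OF infinite_UNIV_nat] by blast
  then have "t = u" using fun_cong[OF eq, of a] by (simp add: charged_def)
  moreover have "p = q"
  proof
    fix i show "p i = q i" using fun_cong[OF eq, of i] \<open>t = u\<close> by (simp add: charged_def)
  qed
  ultimately show ?thesis by simp
qed

lemma range_charged_zero: "range (charged (\<lambda>_. 0) t) = {..t}"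
proof -
  have "x \<in> range (charged (\<lambda>_. 0) t)" if "x \<le> t" for x
    using that by (intro image_eqI[of _ _ "nat (t - x)"]) (auto simp: charged_def)
  then show ?thesis by (auto simp: charged_def)
qed

text \<open>
  Induction on the beads above the filled part: a new bead above all others becomes a new first
  part, and the charge grows by one because all other parts move down one place.
\<close>
lemma ex_charged_range:
  assumes "finite F" "\<forall>x\<in>F. M < x"
  shows "\<exists>p t. is_partition p \<and> range (charged p t) = {..M} \<union> F"
  using assms
proof (induction F rule: finite_linorder_max_induct)
  case empty
  have "is_partition (\<lambda>_. 0)" by (auto simp: is_partition_def antimono_def)
  then show ?case using range_charged_zero[of M] by auto
next
  case (insert b F)
  then obtain p t where p: "is_partition p" and r: "range (charged p t) = {..M} \<union> F" by auto
  have "charged p t 0 \<in> {..M} \<union> F" using r by blast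
  then have b: "charged p t 0 < b" using insert by auto
  define q where "q = case_nat (nat (b - t - 1)) p"
  have q: "is_partition q"
  proof -
    have am: "antimono p" "finite {a. p a \<noteq> 0}" using p by (auto simp: is_partition_def)
    have "a \<in> insert 0 (Suc ` {a. p a \<noteq> 0})" if "q a \<noteq> 0" for a
      using that by (cases a) (auto simp: q_def)
    then have "{a. q a \<noteq> 0} \<subseteq> insert 0 (Suc ` {a. p a \<noteq> 0})" by blast
    moreover have "q (Suc n) \<le> q n" for n
    proof (cases n)
      case 0
      then show ?thesis using b by (auto simp: q_def charged_def)
    next
      case (Suc m)
      then show ?thesis using am by (auto simp: q_def antimono_def)
    qed
    then have "antimono q" by (auto simp: antimono_iff_le_Suc)
    ultimately show ?thesis using am finite_subset by (fastforce simp: is_partition_def)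
  qed
  have 0: "charged q (t + 1) 0 = b" using b by (auto simp: q_def charged_def)
  have S: "charged q (t + 1) (Suc i) = charged p t i" for i by (auto simp: q_def charged_def)
  have "range (charged q (t + 1)) = insert b (range (charged p t))"
  proof -
    have "range (charged q (t + 1)) = charged q (t + 1) ` insert 0 (Suc ` UNIV)"
      by (intro arg_cong[of _ _ "image _"]) (auto simp: image_iff intro: nat.exhaust)
    also have "\<dots> = insert b (range (charged p t))"
      by (simp only: image_insert image_image 0 S)
    finally show ?thesis .
  qed
  then show ?case using q r by (intro exI[of _ q] exI[of _ "t + 1"]) auto
qed

section \<open>Symbols as sets of beads\<close>

definition beads :: "mpart \<Rightarrow> int list \<Rightarrow> (int \<times> nat) set" where
  "beads lam s = {(x, c). c < length lam \<and> x \<in> range (symb lam s c)}"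

text \<open>
  The sets of beads of charged multipartitions: every row is bounded above and full far below.
\<close>
definition abacus :: "nat \<Rightarrow> (int \<times> nat) set \<Rightarrow> bool" where
  "abacus l B \<longleftrightarrow> snd ` B \<subseteq> {..<l} \<and> (\<exists>K. \<forall>b\<in>B. fst b \<le> K) \<and> (\<exists>M. {..M} \<times> {..<l} \<subseteq> B)"

definition charged_mpart :: "nat \<Rightarrow> mpart \<times> int list \<Rightarrow> bool" where
  "charged_mpart l = (\<lambda>(lam, s). is_mpart l lam \<and> length s = l)"

lemma int_Max_exists:
  fixes f :: "nat \<Rightarrow> int" shows "\<exists>K. \<forall>c<l. f c \<le> K"
proof (induction l)
  case (Suc l)
  then obtain K where "\<forall>c<l. f c \<le> K" by auto
  then show ?case by (intro exI[of _ "max K (f l)"]) (auto simp: less_Suc_eq le_max_iff_disj)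
qed auto

lemma range_charged_bounds:
  assumes p: "is_partition p"
  shows "range (charged p t) \<subseteq> {..charged p t 0}" "\<exists>M. {..M} \<subseteq> range (charged p t)"
proof -
  show "range (charged p t) \<subseteq> {..charged p t 0}"
  proof (clarsimp)
    fix i show "charged p t i \<le> charged p t 0"
      using charged_strict_antimono[OF p, of 0 i t] by (cases "i = 0") auto
  qed
  have "finite {a. p a \<noteq> 0}" using p by (auto simp: is_partition_def)
  then obtain N where N: "\<And>a. p a \<noteq> 0 \<Longrightarrow> a < N" by (auto simp: finite_nat_set_iff_bounded)
  have "{..t - int N} \<subseteq> range (charged p t)"
  proof
    fix x assume "x \<in> {..t - int N}"
    then have x: "x \<le> t - int N" by simp
    then have "p (nat (t - x)) = 0" using N[of "nat (t - x)"] by fastforce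
    then show "x \<in> range (charged p t)"
      using x by (intro image_eqI[of _ _ "nat (t - x)"]) (auto simp: charged_def)
  qed
  then show "\<exists>M. {..M} \<subseteq> range (charged p t)" by blast
qed

lemma abacus_beads:
  assumes "charged_mpart l (lam, s)"
  shows "abacus l (beads lam s)"
proof -
  have len: "length lam = l" and p: "\<And>c. c < l \<Longrightarrow> is_partition (lam ! c)"
    using assms by (auto simp: charged_mpart_def is_mpart_def)
  obtain K where K: "\<forall>c<l. charged (lam ! c) (s ! c) 0 \<le> K"
    using int_Max_exists[of l "\<lambda>c. charged (lam ! c) (s ! c) 0"] by blast
  have "\<forall>c. \<exists>M. c < l \<longrightarrow> {..M} \<subseteq> range (charged (lam ! c) (s ! c))"
    using range_charged_bounds(2) p by blast
  then obtain M where M: "\<And>c. c < l \<Longrightarrow> {..M c} \<subseteq> range (charged (lam ! c) (s ! c))" by metis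
  obtain K' where K': "\<forall>c<l. - M c \<le> K'"
    using int_Max_exists[of l "\<lambda>c. - M c"] by blast
  have "fst b \<le> K" if "b \<in> beads lam s" for b
  proof -
    obtain x c where bx: "b = (x, c)" by (cases b)
    then have b: "b = (x, c)" "c < l" "x \<in> range (charged (lam ! c) (s ! c))"
      using that len by (simp_all add: beads_def symb_charged)
    then have "x \<le> charged (lam ! c) (s ! c) 0" using range_charged_bounds(1)[OF p] by blast
    then show ?thesis using b K by force
  qed
  moreover have "{..- K'} \<times> {..<l} \<subseteq> beads lam s"
  proof (rule subrelI)
    fix x c assume "(x, c) \<in> {..- K'} \<times> {..<l}"
    then have "c < l" "x \<le> - K'" by auto
    moreover have "- M c \<le> K'" using K' \<open>c < l\<close> by blast
    ultimately have "x \<in> {..M c}" "c < l" by auto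
    then show "(x, c) \<in> beads lam s" using M[of c] len by (auto simp: beads_def symb_charged)
  qed
  moreover have "snd ` beads lam s \<subseteq> {..<l}" by (auto simp: beads_def len)
  ultimately show ?thesis unfolding abacus_def by blast
qed

lemma ex_charged_mpart_beads:
  assumes "abacus l B"
  shows "\<exists>mu t. charged_mpart l (mu, t) \<and> beads mu t = B"
proof -
  obtain K M where rows: "snd ` B \<subseteq> {..<l}" and K: "\<forall>b\<in>B. fst b \<le> K" and M: "{..M} \<times> {..<l} \<subseteq> B"
    using assms unfolding abacus_def by blast
  have "\<exists>p t. is_partition p \<and> range (charged p t) = {x. (x, c) \<in> B}" if c: "c < l" for c
  proof -
    let ?F = "{x. (x, c) \<in> B \<and> M < x}"
    have "?F \<subseteq> {M<..K}" using K by auto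
    then have "finite ?F" by (rule finite_subset) auto
    moreover have "{..M} \<union> ?F = {x. (x, c) \<in> B}" using M c by auto
    moreover obtain p t where "is_partition p" "range (charged p t) = {..M} \<union> ?F"
      using ex_charged_range[OF \<open>finite ?F\<close>, of M] by blast
    ultimately show ?thesis by metis
  qed
  then obtain p t where pt: "\<And>c. c < l \<Longrightarrow> is_partition (p c)"
      "\<And>c. c < l \<Longrightarrow> range (charged (p c) (t c)) = {x. (x, c) \<in> B}" by metis
  let ?mu = "map p [0..<l]" and ?t = "map t [0..<l]"
  have "(x, c) \<in> beads ?mu ?t \<longleftrightarrow> (x, c) \<in> B" for x c
  proof (cases "c < l")
    case True
    then show ?thesis using pt(2)[of c] by (simp add: beads_def symb_charged)
  next
    case False
    then show ?thesis using rows by (auto simp: beads_def)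
  qed
  then have "beads ?mu ?t = B" by auto
  moreover have "charged_mpart l (?mu, ?t)" using pt by (auto simp: charged_mpart_def is_mpart_def)
  ultimately show ?thesis by blast
qed

lemma beads_inject:
  assumes "charged_mpart l (lam, s)" "charged_mpart l (mu, t)" "beads lam s = beads mu t"
  shows "lam = mu \<and> s = t"
proof -
  have *: "lam ! c = mu ! c \<and> s ! c = t ! c" if "c < l" for c
  proof (rule charged_range_unique)
    show "is_partition (lam ! c)" "is_partition (mu ! c)"
      using assms that by (auto simp: charged_mpart_def is_mpart_def)
    have "x \<in> range (symb lam s c) \<longleftrightarrow> (x, c) \<in> beads lam s" for x
      using assms(1) that by (auto simp: beads_def charged_mpart_def is_mpart_def)
    moreover have "x \<in> range (symb mu t c) \<longleftrightarrow> (x, c) \<in> beads mu t" for x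
      using assms(2) that by (auto simp: beads_def charged_mpart_def is_mpart_def)
    ultimately show "range (charged (lam ! c) (s ! c)) = range (charged (mu ! c) (t ! c))"
      using assms(3) unfolding symb_charged[symmetric] by blast
  qed
  then show ?thesis using assms
    by (auto simp: charged_mpart_def is_mpart_def intro!: nth_equalityI)
qed

lemma symb_inject:
  assumes "charged_mpart l (lam, s)" "c < l"
  shows "symb lam s c i = symb lam s c j \<longleftrightarrow> i = j"
  using assms charged_eq_iff unfolding symb_charged charged_mpart_def is_mpart_def by blast

lemma symb_in_beads:
  assumes "charged_mpart l (lam, s)" "c < l"
  shows "(symb lam s c i, c) \<in> beads lam s"
  using assms by (auto simp: charged_mpart_def is_mpart_def beads_def)

lemma in_beadsE:
  assumes "charged_mpart l (lam, s)" "(x, c) \<in> beads lam s"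
  obtains i where "c < l" "symb lam s c i = x"
  using assms by (auto simp: charged_mpart_def is_mpart_def beads_def)

lemma in_beads_iff:
  assumes "charged_mpart l (lam, s)"
  shows "(x, c) \<in> beads lam s \<longleftrightarrow> c < l \<and> (\<exists>i. symb lam s c i = x)"
  using assms by (auto simp: charged_mpart_def is_mpart_def beads_def)

section \<open>Counting beads of one residue\<close>

text \<open>
  The residue class of \<open>x\<close> is traversed by decreasing values, and inside one value from the bottom row
  upwards. Making the row bound strict means that \<open>(x, 0)\<close> and \<open>(x + e, l)\<close> mark the same
  place, which turns the passage from one value to the next into a change of coordinates.
\<close>
definition above :: "nat \<Rightarrow> int \<Rightarrow> nat \<Rightarrow> (int \<times> nat) set" where
  "above e x c = {(y, d). int e dvd y - x \<and> (x < y \<or> y = x \<and> d < c)}"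

definition count :: "nat \<Rightarrow> (int \<times> nat) set \<Rightarrow> int \<Rightarrow> nat \<Rightarrow> nat" where
  "count e B x c = card (B \<inter> above e x c)"

definition decreasing_counts :: "nat \<Rightarrow> (int \<times> nat) set \<Rightarrow> bool" where
  "decreasing_counts e B \<longleftrightarrow> (\<forall>x c. count e B (x + 1) c \<le> count e B x c)"

lemma finite_above:
  assumes "abacus l B" shows "finite (B \<inter> above e x c)"
proof -
  obtain K where rows: "snd ` B \<subseteq> {..<l}" and K: "\<forall>b\<in>B. fst b \<le> K"
    using assms unfolding abacus_def by blast
  have "B \<inter> above e x c \<subseteq> {x..K} \<times> {..<l}"
    using rows K by (fastforce simp: above_def)
  then show ?thesis by (rule finite_subset) auto
qed

lemma count_Suc:
  assumes "abacus l B"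
  shows "count e B x (Suc c) = count e B x c + (if (x, c) \<in> B then 1 else 0)"
proof -
  have "above e x (Suc c) = insert (x, c) (above e x c)" "(x, c) \<notin> above e x c"
    by (auto simp: above_def)
  then show ?thesis using finite_above[OF assms, of e x c]
    by (auto simp: count_def Int_insert_right)
qed

lemma count_wrap:
  assumes "abacus l B" "0 < e"
  shows "count e B x 0 = count e B (x + int e) l"
proof -
  have "(y, d) \<in> above e x 0 \<longleftrightarrow> (y, d) \<in> above e (x + int e) l" if "(y, d) \<in> B" for y d
  proof -
    have d: "d < l" using that assms(1) by (auto simp: abacus_def)
    have dv: "int e dvd y - (x + int e) \<longleftrightarrow> int e dvd y - x"
      by (metis diff_diff_eq dvd_diff_right_iff dvd_refl dvd_minus_iff dvd_diff_left_iff)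
    have "x + int e \<le> y" if "int e dvd y - x" "x < y"
      using zdvd_imp_le[OF that(1)] that(2) by auto
    then show ?thesis using d dv assms(2) by (auto simp: above_def)
  qed
  then have "B \<inter> above e x 0 = B \<inter> above e (x + int e) l" by auto
  then show ?thesis by (simp add: count_def)
qed

lemma count_mono_row:
  assumes "abacus l B" "c \<le> d"
  shows "count e B x c \<le> count e B x d"
  unfolding count_def using assms(2)
  by (intro card_mono finite_above[OF assms(1)]) (auto simp: above_def)

lemma decreasing_countsD:
  assumes "decreasing_counts e B" "x \<le> y"
  shows "count e B y c \<le> count e B x c"
  using assms(2)
proof (induction y rule: int_ge_induct)
  case (step i)
  then show ?case using assms(1) order_trans unfolding decreasing_counts_def by blast
qed simp

section \<open>Periods\<close>

text \<open>
  A period seen on beads: \<open>r x\<close> is the row of the period bead with value \<open>x\<close>. The condition that the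
  rows \<open>c\<^sub>1 \<ge> \<dots> \<ge> c\<^sub>e\<close> go down with the values becomes monotonicity of \<open>r\<close>.
\<close>
definition bead_period :: "nat \<Rightarrow> (int \<times> nat) set \<Rightarrow> int \<Rightarrow> (int \<Rightarrow> nat) \<Rightarrow> bool" where
  "bead_period e B k r \<longleftrightarrow>
     (\<forall>b\<in>B. fst b \<le> k) \<and> mono_on {k - int e<..k} r \<and>
     (\<forall>x\<in>{k - int e<..k}. (x, r x) \<in> B \<and> (\<forall>d<r x. (x, d) \<notin> B))"

definition period_beads :: "nat \<Rightarrow> int \<Rightarrow> (int \<Rightarrow> nat) \<Rightarrow> (int \<times> nat) set" where
  "period_beads e k r = (\<lambda>x. (x, r x)) ` {k - int e<..k}"

lemma period_beads_unique:
  assumes "bead_period e B k r" "bead_period e B k' r'" "0 < e"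
  shows "period_beads e k r = period_beads e k' r'"
proof -
  have "(k, r k) \<in> B" "(k', r' k') \<in> B" using assms by (auto simp: bead_period_def)
  moreover have "\<forall>b\<in>B. fst b \<le> k" "\<forall>b\<in>B. fst b \<le> k'" using assms by (auto simp: bead_period_def)
  ultimately have k: "k = k'" by force
  have "r x = r' x" if "x \<in> {k' - int e<..k'}" for x
  proof -
    have "(x, r x) \<in> B" "(x, r' x) \<in> B" "\<forall>d<r x. (x, d) \<notin> B" "\<forall>d<r' x. (x, d) \<notin> B"
      using assms that by (auto simp: bead_period_def k)
    then show ?thesis by (meson linorder_cases)
  qed
  then show ?thesis unfolding period_beads_def k by (auto intro!: image_cong)
qed

lemma ex_residue_in_window:
  assumes "0 < e" shows "\<exists>p. k - int e < p \<and> p \<le> k \<and> int e dvd p - x"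
proof -
  let ?p = "k - (k - x) mod int e"
  have "?p - x = int e * ((k - x) div int e)" by (simp add: minus_mod_eq_mult_div[symmetric])
  moreover have "0 \<le> (k - x) mod int e" "(k - x) mod int e < int e" using assms by auto
  ultimately show ?thesis by (intro exI[of _ ?p]) auto
qed

lemma window_residue_unique:
  assumes "k - int e < p" "p \<le> k" "k - int e < q" "q \<le> k" "int e dvd p - q"
  shows "p = q"
proof (rule ccontr)
  assume "p \<noteq> q"
  then have "\<bar>int e\<bar> \<le> \<bar>p - q\<bar>" using assms(5) dvd_imp_le_int[of "p - q" "int e"] by auto
  then show False using assms(1-4) by auto
qed

lemma bead_period_abacus:
  assumes "abacus l B" "bead_period e B k r"
  shows "abacus l (B - period_beads e k r)"
proof -
  obtain K M where rows: "snd ` B \<subseteq> {..<l}" and K: "\<forall>b\<in>B. fst b \<le> K" and M: "{..M} \<times> {..<l} \<subseteq> B"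
    using assms(1) unfolding abacus_def by blast
  have "{..min M (k - int e)} \<times> {..<l} \<subseteq> B - period_beads e k r"
    using M by (auto simp: period_beads_def)
  then show ?thesis using rows K unfolding abacus_def by blast
qed

text \<open>
  Let \<open>p\<close> be the value in the window \<open>{k - e<..k}\<close> that is congruent to \<open>x\<close>. No bead of this
  residue class precedes \<open>(p, r p)\<close>: larger values would exceed \<open>k\<close>, and \<open>r p\<close> is the lowest row
  containing \<open>p\<close>. So a nonempty initial segment of the class loses exactly this bead.
\<close>
lemma count_remove_period:
  assumes ab: "abacus l B" and per: "bead_period e B k r" and e: "0 < e"
  shows "count e (B - period_beads e k r) x c = count e B x c - 1"
proof -
  let ?X = "B \<inter> above e x c"
  obtain p where p: "k - int e < p" "p \<le> k" "int e dvd p - x" using ex_residue_in_window[OF e] by blast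
  have pB: "(p, r p) \<in> B" using per p by (auto simp: bead_period_def)
  have sub: "?X \<inter> period_beads e k r \<subseteq> {(p, r p)}"
  proof
    fix b assume "b \<in> ?X \<inter> period_beads e k r"
    then obtain q where q: "b = (q, r q)" "k - int e < q" "q \<le> k" "int e dvd q - x"
      by (auto simp: period_beads_def above_def)
    have "int e dvd q - p" using dvd_diff[OF q(4) p(3)] by simp
    then have "q = p" using window_residue_unique[of k e q p] q p by auto
    then show "b \<in> {(p, r p)}" using q by simp
  qed
  have "B \<inter> above e x c - period_beads e k r = ?X - {(p, r p)}" if "(p, r p) \<in> ?X"
    using that sub p by (auto simp: period_beads_def)
  moreover have "(p, r p) \<in> ?X" if ne: "?X \<noteq> {}"
  proof -
    obtain y d where yd: "(y, d) \<in> B" "int e dvd y - x" "x < y \<or> y = x \<and> d < c"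
      using ne by (auto simp: above_def)
    have yk: "y \<le> k" using per yd(1) by (auto simp: bead_period_def)
    have yp: "y \<le> p"
    proof (rule ccontr)
      assume "\<not> y \<le> p"
      moreover have "int e dvd y - p" using dvd_diff[OF yd(2) p(3)] by simp
      ultimately have "y = p" using window_residue_unique[of k e y p] p yk by auto
      then show False using \<open>\<not> y \<le> p\<close> by simp
    qed
    have "r p \<le> d" if "y = p"
      using per p yd(1) that unfolding bead_period_def by (meson greaterThanAtMost_iff leI)
    then show ?thesis using yd yp p pB by (auto simp: above_def)
  qed
  moreover have "(B - period_beads e k r) \<inter> above e x c = B \<inter> above e x c - period_beads e k r"
    by auto
  ultimately show ?thesis using finite_above[OF ab, of e x c] unfolding count_def
    by (cases "?X = {}") auto
qed

text \<open>
  A count is positive exactly when the period bead of its class is counted. In the window this says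
  \<open>r x < c\<close>, and \<open>r x \<le> r (x + 1)\<close>; below the window all counts are positive, above it none is.
\<close>
lemma count_pos_decreasing:
  assumes ab: "abacus l B" and per: "bead_period e B k r" and e: "0 < e"
    and pos: "0 < count e B (x + 1) c"
  shows "0 < count e B x c"
proof -
  have fin: "\<And>x c. finite (B \<inter> above e x c)" using finite_above[OF ab] .
  have ne: "0 < count e B z d \<longleftrightarrow> B \<inter> above e z d \<noteq> {}" for z d
    using fin[of z d] by (auto simp: count_def card_gt_0_iff)
  obtain y d where yd: "(y, d) \<in> B" "int e dvd y - (x + 1)" "x + 1 < y \<or> y = x + 1 \<and> d < c"
    using pos ne[of "x + 1" c] by (auto simp: above_def)
  have yk: "y \<le> k" using per yd(1) by (auto simp: bead_period_def)
  obtain p where p: "k - int e < p" "p \<le> k" "int e dvd p - x" using ex_residue_in_window[OF e] by blast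
  have pB: "(p, r p) \<in> B" using per p by (auto simp: bead_period_def)
  have "x < p \<or> p = x \<and> r p < c"
  proof (cases "x \<le> k - int e")
    case True then show ?thesis using p by auto
  next
    case False
    then have "p = x" using window_residue_unique[of k e p x] p yk yd(3) by auto
    have "y = x + 1" using window_residue_unique[of k e y "x + 1"] False yk yd by auto
    then have "d < c" using yd by auto
    have win: "x \<in> {k - int e<..k}" "x + 1 \<in> {k - int e<..k}"
      using False yk \<open>y = x + 1\<close> by auto
    have "\<forall>d<r (x + 1). (x + 1, d) \<notin> B" "mono_on {k - int e<..k} r"
      using per win unfolding bead_period_def by blast+
    then have "r (x + 1) \<le> d" "r x \<le> r (x + 1)"
      using yd(1) \<open>y = x + 1\<close> win by (auto simp: not_less[symmetric] mono_on_def)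
    then show ?thesis using \<open>p = x\<close> \<open>d < c\<close> by auto
  qed
  then show ?thesis using pB p ne[of x c] by (auto simp: above_def)
qed

text \<open>
  Truncated subtraction of one can hide a failure of \<open>count e B (x + 1) c \<le> count e B x c\<close> only if
  the larger side is one and the smaller side is zero, which positivity excludes.
\<close>
lemma decreasing_counts_remove_period:
  assumes ab: "abacus l B" and per: "bead_period e B k r" and e: "0 < e"
  shows "decreasing_counts e (B - period_beads e k r) \<longleftrightarrow> decreasing_counts e B"
proof -
  have "count e B (x + 1) c - 1 \<le> count e B x c - 1 \<longleftrightarrow> count e B (x + 1) c \<le> count e B x c" for x c
    using count_pos_decreasing[OF assms, of x c] by arith
  then show ?thesis unfolding decreasing_counts_def count_remove_period[OF assms] by simp
qed

text \<open>
  With \<open>k\<close> the largest value, the counts at a value \<open>x\<close> in \<open>{k - e<..k}\<close> see only beads of value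
  \<open>x\<close> itself: \<open>count e B x c\<close> is positive exactly if \<open>x\<close> occurs below row \<open>c\<close>. Decreasing counts
  propagate this from \<open>k\<close> downwards, which gives both the existence of the beads and the monotonicity
  of their lowest rows.
\<close>
lemma decreasing_counts_imp_bead_period:
  assumes ab: "abacus l B" and dec: "decreasing_counts e B" and l: "0 < l" and e: "0 < e"
  shows "\<exists>k r. bead_period e B k r"
proof -
  obtain K M where rows: "snd ` B \<subseteq> {..<l}" and K: "\<forall>b\<in>B. fst b \<le> K" and M: "{..M} \<times> {..<l} \<subseteq> B"
    using ab unfolding abacus_def by blast
  let ?F = "{x\<in>fst ` B. M \<le> x}"
  have "?F \<subseteq> {M..K}" using K by auto
  then have fin: "finite ?F" by (rule finite_subset) auto
  have MB: "(M, 0) \<in> B" using M l by auto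
  then have "M \<in> ?F" by force
  define k where "k = Max ?F"
  have kF: "k \<in> ?F" unfolding k_def using Max_in[OF fin] \<open>M \<in> ?F\<close> by blast
  have max: "fst b \<le> k" if "b \<in> B" for b
  proof (cases "M \<le> fst b")
    case True
    then show ?thesis unfolding k_def using that by (intro Max_ge[OF fin]) simp
  next
    case False
    then show ?thesis using kF by simp
  qed
  obtain c0 where c0: "(k, c0) \<in> B" using kF by auto
  have fa: "\<And>x c. finite (B \<inter> above e x c)" using finite_above[OF ab] .
  have pos: "0 < count e B x c \<longleftrightarrow> (\<exists>d<c. (x, d) \<in> B)" if "x \<in> {k - int e<..k}" for x c
  proof -
    have "y = x" if "(y, d) \<in> B" "int e dvd y - x" "x \<le> y" for y d
      using window_residue_unique[of k e y x] that \<open>x \<in> _\<close> max[OF that(1)] by auto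
    then have "B \<inter> above e x c = {(x, d) | d. d < c \<and> (x, d) \<in> B}" by (fastforce simp: above_def)
    then show ?thesis using fa[of x c] by (auto simp: count_def card_gt_0_iff)
  qed
  define r where "r x = (LEAST d. (x, d) \<in> B)" for x
  have r: "(x, r x) \<in> B" "\<forall>d<r x. (x, d) \<notin> B" if x: "x \<in> {k - int e<..k}" for x
  proof -
    have "0 < count e B k (Suc c0)" using pos[of k "Suc c0"] c0 e by auto
    also have "\<dots> \<le> count e B x (Suc c0)" using decreasing_countsD[OF dec] x by auto
    finally have "\<exists>d. (x, d) \<in> B" using pos[OF x] by auto
    then show "(x, r x) \<in> B" unfolding r_def by (rule LeastI_ex)
    show "\<forall>d<r x. (x, d) \<notin> B" unfolding r_def using not_less_Least by blast
  qed
  have "r x \<le> r y" if x: "x \<in> {k - int e<..k}" and y: "y \<in> {k - int e<..k}" and "x \<le> y" for x y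
  proof -
    have "0 < count e B y (Suc (r y))" using pos[OF y] r[OF y] by auto
    also have "\<dots> \<le> count e B x (Suc (r y))" using decreasing_countsD[OF dec \<open>x \<le> y\<close>] .
    finally obtain d where "d \<le> r y" "(x, d) \<in> B" using pos[OF x] by (auto simp: less_Suc_eq_le)
    then show ?thesis using r(2)[OF x] by (meson leI order_trans)
  qed
  then have "mono_on {k - int e<..k} r" by (auto simp: mono_on_def)
  then show ?thesis using r max unfolding bead_period_def by blast
qed

lemma is_period_imp_bead_period:
  assumes v: "charged_mpart l (lam, s)" and e: "0 < e" and per: "is_period l e lam s k ps"
  defines "r \<equiv> \<lambda>x. snd (ps ! nat (k - x))"
  shows "bead_period e (beads lam s) k r"
    and "\<And>c. c < l \<Longrightarrow>
      symb lam s c ` {i. (i, c) \<notin> set ps} = {x. (x, c) \<in> beads lam s - period_beads e k r}"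
proof -
  have len: "length ps = e" and row: "\<And>t. t < e \<Longrightarrow> snd (ps ! t) < l"
    and val: "\<And>t. t < e \<Longrightarrow> symb lam s (snd (ps ! t)) (fst (ps ! t)) = k - int t"
    and sorted: "sorted_wrt (\<ge>) (map snd ps)" and mx: "\<And>c i. c < l \<Longrightarrow> symb lam s c i \<le> k"
    and low: "\<And>t d i. t < e \<Longrightarrow> d < snd (ps ! t) \<Longrightarrow> symb lam s d i \<noteq> k - int t"
    using per unfolding is_period_def by blast+
  have t: "nat (k - x) < e" "k - int (nat (k - x)) = x" if "x \<in> {k - int e<..k}" for x
    using that by auto
  have in_r: "(x, r x) \<in> beads lam s" if "x \<in> {k - int e<..k}" for x
    using symb_in_beads[OF v row[OF t(1)[OF that]]] val[OF t(1)[OF that]] t(2)[OF that]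
    unfolding r_def by metis
  show bp: "bead_period e (beads lam s) k r"
    unfolding bead_period_def
  proof (intro conjI ballI allI impI)
    show "fst b \<le> k" if "b \<in> beads lam s" for b
      using that mx in_beadsE[OF v, of "fst b" "snd b"] by (metis prod.collapse)
    show "mono_on {k - int e<..k} r"
    proof (rule mono_onI)
      fix x y assume xy: "x \<in> {k - int e<..k}" "y \<in> {k - int e<..k}" "x \<le> y"
      show "r x \<le> r y"
      proof (cases "x = y")
        case False
        then have "nat (k - y) < nat (k - x)" "nat (k - x) < length ps" using xy len by auto
        then show ?thesis using sorted by (simp add: sorted_wrt_iff_nth_less r_def)
      qed simp
    qed
    show "(x, r x) \<in> beads lam s" if "x \<in> {k - int e<..k}" for x using in_r[OF that] .
    show "(x, d) \<notin> beads lam s" if "x \<in> {k - int e<..k}" "d < r x" for x d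
      using low[OF t(1)[OF that(1)], of d] t(2)[OF that(1)] that(2) in_beadsE[OF v, of x d]
      unfolding r_def by metis
  qed
  fix c assume c: "c < l"
  have "(i, c) \<in> set ps \<longleftrightarrow> (symb lam s c i, c) \<in> period_beads e k r" for i
  proof
    assume "(i, c) \<in> set ps"
    then obtain u where u: "u < e" "ps ! u = (i, c)" using len by (auto simp: in_set_conv_nth)
    then have "symb lam s c i = k - int u" "r (k - int u) = c" using val[of u] by (auto simp: r_def)
    then show "(symb lam s c i, c) \<in> period_beads e k r"
      using u unfolding period_beads_def by (intro image_eqI[of _ _ "k - int u"]) auto
  next
    assume "(symb lam s c i, c) \<in> period_beads e k r"
    then have x: "symb lam s c i \<in> {k - int e<..k}" "r (symb lam s c i) = c"
      by (auto simp: period_beads_def)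
    let ?u = "nat (k - symb lam s c i)"
    have "symb lam s c (fst (ps ! ?u)) = symb lam s c i"
      using val[OF t(1)[OF x(1)]] t(2)[OF x(1)] x(2) by (simp add: r_def)
    then have "fst (ps ! ?u) = i" using symb_inject[OF v c] by simp
    then have "ps ! ?u = (i, c)" using x(2) by (auto simp: r_def prod_eq_iff)
    then show "(i, c) \<in> set ps" using t(1)[OF x(1)] len by (metis nth_mem)
  qed
  then show "symb lam s c ` {i. (i, c) \<notin> set ps} = {x. (x, c) \<in> beads lam s - period_beads e k r}"
    using symb_in_beads[OF v c] in_beadsE[OF v, of _ c] by (auto simp: image_iff) metis
qed

lemma bead_period_imp_is_period:
  assumes v: "charged_mpart l (lam, s)" and e: "0 < e" and per: "bead_period e (beads lam s) k r"
  shows "\<exists>ps. is_period l e lam s k ps"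
proof -
  let ?r = "\<lambda>t. r (k - int t)"
  have win: "k - int t \<in> {k - int e<..k}" if "t < e" for t using that by auto
  have mx: "\<forall>b\<in>beads lam s. fst b \<le> k" and mono: "mono_on {k - int e<..k} r"
    and r: "\<And>t. t < e \<Longrightarrow> (k - int t, ?r t) \<in> beads lam s"
    and low: "\<And>t d. t < e \<Longrightarrow> d < ?r t \<Longrightarrow> (k - int t, d) \<notin> beads lam s"
    using per win unfolding bead_period_def by blast+
  have rl: "?r t < l" if "t < e" for t using in_beadsE[OF v r[OF that]] by blast
  have "\<forall>t. \<exists>i. t < e \<longrightarrow> symb lam s (?r t) i = k - int t" using in_beadsE[OF v r] by metis
  then obtain i where i: "\<And>t. t < e \<Longrightarrow> symb lam s (?r t) (i t) = k - int t" by metis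
  let ?ps = "map (\<lambda>t. (i t, ?r t)) [0..<e]"
  have "is_period l e lam s k ?ps"
    unfolding is_period_def
  proof (intro conjI allI impI)
    show "sorted_wrt (\<ge>) (map snd ?ps)"
      using mono_onD[OF mono] by (auto simp: sorted_wrt_iff_nth_less)
    show "\<exists>c<l. \<exists>i. symb lam s c i = k" using rl[OF e] i[OF e] by auto
    show "symb lam s c j \<le> k" if "c < l" for c j using mx symb_in_beads[OF v that, of j] by auto
    show "symb lam s d j \<noteq> k - int t" if t: "t < e" and d: "d < snd (?ps ! t)" for t d j
    proof -
      have d: "d < ?r t" using t d by simp
      then have "d < l" using rl[OF t] by simp
      then show ?thesis using low[OF t d] symb_in_beads[OF v] by metis
    qed
  qed (use rl i in auto)
  then show ?thesis by blast
qed

lemma e_periodic_iff: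
  assumes "charged_mpart l (lam, s)" "0 < e"
  shows "e_periodic l e (lam, s) \<longleftrightarrow> (\<exists>k r. bead_period e (beads lam s) k r)"
  using is_period_imp_bead_period(1)[OF assms] bead_period_imp_is_period[OF assms]
  unfolding e_periodic_def by blast

text \<open>
  The description of the smaller symbol by a unique choice is justified: all periods of a symbol have
  the same beads, and a charged multipartition is determined by its beads.
\<close>
lemma remove_period_beads:
  assumes v: "charged_mpart l (lam, s)" and e: "0 < e"
    and per: "bead_period e (beads lam s) k r"
  obtains mu t where "remove_period l e (lam, s) = (mu, t)" "charged_mpart l (mu, t)"
    "beads mu t = beads lam s - period_beads e k r"
proof -
  let ?B = "beads lam s" and ?P = "period_beads e k r"
  have "abacus l (?B - ?P)" by (rule bead_period_abacus[OF abacus_beads[OF v] per])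
  then obtain mu t where mt: "charged_mpart l (mu, t)" "beads mu t = ?B - ?P"
    using ex_charged_mpart_beads by blast
  have rows: "range (symb nu u c) = {x. (x, c) \<in> beads nu u}"
    if "charged_mpart l (nu, u)" "c < l" for nu u c
    using that by (auto simp: charged_mpart_def is_mpart_def beads_def)
  have removed: "symb lam s c ` {i. (i, c) \<notin> set ps} = {x. (x, c) \<in> ?B - ?P}"
    if ps: "is_period l e lam s k' ps" and "c < l" for k' ps c
  proof -
    note * = is_period_imp_bead_period[OF v e ps]
    show ?thesis
      using *(2)[OF \<open>c < l\<close>] period_beads_unique[OF *(1) per e] by simp
  qed
  let ?spec = "\<lambda>(mu, t). is_mpart l mu \<and> length t = l \<and>
          (\<exists>k ps. is_period l e lam s k ps \<and>
             (\<forall>c<l. range (symb mu t c) = symb lam s c ` {i. (i, c) \<notin> set ps}))"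
  obtain ps where ps: "is_period l e lam s k ps" using bead_period_imp_is_period[OF v e per] by blast
  have "(THE x. ?spec x) = (mu, t)"
  proof (rule the_equality)
    have "\<forall>c<l. range (symb mu t c) = symb lam s c ` {i. (i, c) \<notin> set ps}"
      using rows[OF mt(1)] removed[OF ps] mt(2) by simp
    then show "?spec (mu, t)" using mt(1) ps unfolding charged_mpart_def by blast
  next
    fix x assume x: "?spec x"
    obtain nu u where nu: "x = (nu, u)" by (cases x)
    then obtain k' ps' where ps': "is_period l e lam s k' ps'"
      "\<forall>c<l. range (symb nu u c) = symb lam s c ` {i. (i, c) \<notin> set ps'}" using x by auto
    have vn: "charged_mpart l (nu, u)" using x nu by (auto simp: charged_mpart_def)
    have "(y, c) \<in> beads nu u \<longleftrightarrow> (y, c) \<in> beads mu t" for y c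
    proof (cases "c < l")
      case True
      then show ?thesis using rows[OF vn True] ps'(2) removed[OF ps'(1) True] mt(2) by auto
    next
      case False
      then show ?thesis using in_beadsE[OF vn] in_beadsE[OF mt(1)] by blast
    qed
    then have "beads nu u = beads mu t" by auto
    then show "x = (mu, t)" using beads_inject[OF vn mt(1)] nu by simp
  qed
  moreover have "e_periodic l e (lam, s)" using e_periodic_iff[OF v e] per by blast
  ultimately have "remove_period l e (lam, s) = (mu, t)" by (simp add: remove_period_def)
  then show ?thesis using that mt by blast
qed

section \<open>The end of the peeling procedure\<close>

text \<open>
  The three closure conditions say, in this order, that the rows have no gaps, that
  \<open>t\<^sub>0 \<le> \<dots> \<le> t\<^sub>l\<^sub>-\<^sub>1\<close>, and that \<open>t\<^sub>l\<^sub>-\<^sub>1 - t\<^sub>0 \<le> e - 1\<close>.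
\<close>
lemma is_trivialI:
  assumes v: "charged_mpart l (mu, t)" and l: "0 < l"
    and down: "\<And>x c. (x + 1, c) \<in> beads mu t \<Longrightarrow> (x, c) \<in> beads mu t"
    and up: "\<And>x c. (x, c) \<in> beads mu t \<Longrightarrow> Suc c < l \<Longrightarrow> (x, Suc c) \<in> beads mu t"
    and wrap: "\<And>x. (x, l - 1) \<in> beads mu t \<Longrightarrow> (x - int e + 1, 0) \<in> beads mu t"
  shows "is_trivial l e (mu, t)"
proof -
  have len: "length mu = l" "length t = l" and p: "\<And>c. c < l \<Longrightarrow> is_partition (mu ! c)"
    using v by (auto simp: charged_mpart_def is_mpart_def)
  have zero: "mu ! c = (\<lambda>_. 0)" if c: "c < l" for c
  proof -
    let ?K = "charged (mu ! c) (t ! c) 0"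
    have K: "(?K, c) \<in> beads mu t" using symb_in_beads[OF v c, of 0] by (simp add: symb_charged)
    have "(x, c) \<in> beads mu t" if "x \<le> ?K" for x
      using that
    proof (induction x rule: int_le_induct)
      case (step i)
      then show ?case using down[of "i - 1" c] by simp
    qed (rule K)
    then have "range (charged (mu ! c) (t ! c)) = range (charged (\<lambda>_. 0) ?K)"
      unfolding range_charged_zero using range_charged_bounds(1)[OF p[OF c], of "t ! c"] c len
      by (fastforce simp: beads_def symb_charged)
    then show ?thesis
      using charged_range_unique[OF p[OF c], of "\<lambda>_. 0"] by (auto simp: is_partition_def antimono_def)
  qed
  have B: "(x, c) \<in> beads mu t \<longleftrightarrow> x \<le> t ! c" if "c < l" for x c
    using that len range_charged_zero[of "t ! c"]
    by (simp add: beads_def symb_charged zero[OF that])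
  have "mu = empty_mpart l" using zero len by (intro nth_equalityI) (auto simp: empty_mpart_def)
  moreover have "sorted t"
    unfolding sorted_iff_nth_Suc using up B len by (metis Suc_lessD order_refl)
  moreover have "t ! (l - 1) - t ! 0 \<le> int e - 1"
    using wrap[of "t ! (l - 1)"] B[of "l - 1"] B[of 0] l by auto
  ultimately show ?thesis using len by (auto simp: is_trivial_def T_set_def)
qed

text \<open>
  Rows without gaps are closed under \<open>x \<mapsto> x - 1\<close>, so this shift embeds the beads counted at \<open>x + 1\<close> into
  those counted at \<open>x\<close>.
\<close>
lemma is_trivial_decreasing_counts:
  assumes v: "charged_mpart l (mu, t)" and triv: "is_trivial l e (mu, t)"
  shows "decreasing_counts e (beads mu t)"
proof -
  have "\<And>c. c < l \<Longrightarrow> mu ! c = (\<lambda>_. 0)" "length mu = l"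
    using triv by (auto simp: is_trivial_def empty_mpart_def)
  then have down: "(x, c) \<in> beads mu t" if "(x + 1, c) \<in> beads mu t" for x c
  proof -
    have c: "c < l" "length mu = l" using that in_beadsE[OF v] v
      by (auto simp: charged_mpart_def is_mpart_def)
    then show ?thesis using that \<open>\<And>c. c < l \<Longrightarrow> mu ! c = (\<lambda>_. 0)\<close>[OF c(1)]
      by (simp add: beads_def symb_charged range_charged_zero)
  qed
  have "count e (beads mu t) (x + 1) c \<le> count e (beads mu t) x c" for x c
  proof -
    have "(\<lambda>(y, d). (y - 1, d)) ` (beads mu t \<inter> above e (x + 1) c) \<subseteq> beads mu t \<inter> above e x c"
      using down[of "_ - 1"] by (auto simp: above_def algebra_simps)
    then show ?thesis unfolding count_def
      using finite_above[OF abacus_beads[OF v]] by (intro card_inj_on_le) (auto simp: inj_on_def)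
  qed
  then show ?thesis by (simp add: decreasing_counts_def)
qed

text \<open>
  All places with values up to \<open>z\<close> carry beads of \<open>B\<close>, so after truncation by
  \<open>m = count e B z l\<close> a place carries a bead exactly when its count exceeds \<open>m\<close>. Closure under
  \<open>x \<mapsto> x - 1\<close> and \<open>c \<mapsto> c + 1\<close> is then monotonicity of the counts.

  The bound \<open>e - 1\<close> instead of \<open>e\<close> for the spread of the charges depends on \<open>m\<close> being itself a
  value of \<open>count e B _ l\<close>: if \<open>count e B x l > m\<close>, then \<open>x < z\<close>, hence
  \<open>count e B (x + 1) l \<ge> m\<close>; as \<open>(x + 1 - e, 0)\<close> is the next place after those counted here, its
  bead is kept. For other \<open>m\<close> the spread can be \<open>e\<close>: deleting a period from a trivial symbol can
  give a nontrivial one.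
\<close>
lemma is_trivial_of_truncated_counts:
  assumes ab: "abacus l B" and dec: "decreasing_counts e B" and l: "0 < l" and e: "0 < e"
    and M: "{..z} \<times> {..<l} \<subseteq> B" and v: "charged_mpart l (mu, t)"
    and trunc: "\<And>x c. count e (beads mu t) x c = count e B x c - count e B z l"
  shows "is_trivial l e (mu, t)"
proof -
  let ?m = "count e B z l"
  have ab': "abacus l (beads mu t)" by (rule abacus_beads[OF v])
  have z: "x < z" if "?m < count e B x c" "c \<le> l" for x c
  proof (rule ccontr)
    assume "\<not> x < z"
    then have "count e B x c \<le> count e B z c" using decreasing_countsD[OF dec] by simp
    also have "\<dots> \<le> ?m" by (rule count_mono_row[OF ab that(2)])
    finally show False using that by simp
  qed
  have mem: "(x, c) \<in> beads mu t \<longleftrightarrow> ?m < count e B x (Suc c)" if c: "c < l" for x c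
  proof
    assume "(x, c) \<in> beads mu t"
    then have "0 < count e (beads mu t) x (Suc c)" using count_Suc[OF ab'] by simp
    then show "?m < count e B x (Suc c)" by (simp add: trunc)
  next
    assume m: "?m < count e B x (Suc c)"
    then have "(x, c) \<in> B" using z[OF m] c M by auto
    then have "count e B x (Suc c) = count e B x c + 1" using count_Suc[OF ab] by simp
    then have "count e (beads mu t) x (Suc c) \<noteq> count e (beads mu t) x c"
      using m by (simp add: trunc)
    then show "(x, c) \<in> beads mu t" using count_Suc[OF ab', of e x c] by (simp split: if_splits)
  qed
  have rows: "c < l" if "(x, c) \<in> beads mu t" for x c using in_beadsE[OF v that] by blast
  show ?thesis
  proof (rule is_trivialI[OF v l])
    show "(x, c) \<in> beads mu t" if "(x + 1, c) \<in> beads mu t" for x c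
      using that rows[OF that] mem[of c] decreasing_countsD[OF dec, of x "x + 1" "Suc c"] by simp
    show "(x, Suc c) \<in> beads mu t" if "(x, c) \<in> beads mu t" "Suc c < l" for x c
      using that mem[of c] mem[of "Suc c"] count_mono_row[OF ab, of "Suc c" "Suc (Suc c)" e x] by simp
    show "(x - int e + 1, 0) \<in> beads mu t" if "(x, l - 1) \<in> beads mu t" for x
    proof -
      have m: "?m < count e B x l" using that mem[of "l - 1"] l by simp
      then have "x < z" using z by simp
      then have "?m \<le> count e B (x + 1) l" using decreasing_countsD[OF dec, of "x + 1" z l] by simp
      also have "\<dots> = count e B (x - int e + 1) 0"
        using count_wrap[OF ab e, of "x - int e + 1"] by (simp add: algebra_simps)
      also have "\<dots> < count e B (x - int e + 1) (Suc 0)"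
        using M \<open>x < z\<close> l e count_Suc[OF ab, of e "x - int e + 1" 0] by auto
      finally show ?thesis using mem[of 0] l by simp
    qed
  qed
qed

lemma peel_iterates:
  assumes v: "charged_mpart l (lam, s)" and dec: "decreasing_counts e (beads lam s)"
    and l: "0 < l" and e: "0 < e"
  shows "\<exists>mu t. (remove_period l e ^^ j) (lam, s) = (mu, t) \<and> charged_mpart l (mu, t) \<and>
           decreasing_counts e (beads mu t) \<and>
           (\<forall>x c. count e (beads mu t) x c = count e (beads lam s) x c - j)"
proof (induction j)
  case 0
  show ?case using v dec by auto
next
  case (Suc j)
  then obtain mu t where IH: "(remove_period l e ^^ j) (lam, s) = (mu, t)" "charged_mpart l (mu, t)"
     "decreasing_counts e (beads mu t)"
     "\<forall>x c. count e (beads mu t) x c = count e (beads lam s) x c - j" by blast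
  note ab = abacus_beads[OF IH(2)]
  obtain k r where per: "bead_period e (beads mu t) k r"
    using decreasing_counts_imp_bead_period[OF ab IH(3) l e] by blast
  obtain mu' t' where rem: "remove_period l e (mu, t) = (mu', t')" "charged_mpart l (mu', t')"
    "beads mu' t' = beads mu t - period_beads e k r" using remove_period_beads[OF IH(2) e per] .
  have "decreasing_counts e (beads mu' t')"
    using decreasing_counts_remove_period[OF ab per e] IH(3) rem(3) by simp
  moreover have "count e (beads mu' t') x c = count e (beads lam s) x c - Suc j" for x c
    using count_remove_period[OF ab per e, of x c] IH(4) rem(3) by simp
  ultimately show ?case using IH(1) rem by auto
qed

text \<open>
  One direction runs forwards along the peeling, carrying decreasing counts to its last symbol; the
  other carries their failure forwards, which contradicts triviality of the last symbol.
\<close>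
lemma decreasing_counts_iff_totally_periodic:
  assumes v: "charged_mpart l (lam, s)" and l: "0 < l" and e: "0 < e"
  shows "decreasing_counts e (beads lam s) \<longleftrightarrow> totally_periodic l e lam s"
proof
  assume dec: "decreasing_counts e (beads lam s)"
  let ?b = "\<lambda>x. e_periodic l e x \<and> \<not> is_trivial l e x"
  note ab = abacus_beads[OF v] and it = peel_iterates[OF v dec l e]
  \<comment> \<open>Any \<open>z\<close> in the full part will do; it fixes the number of deletions.\<close>
  obtain z where z: "{..z} \<times> {..<l} \<subseteq> beads lam s" using ab unfolding abacus_def by blast
  let ?m = "count e (beads lam s) z l"
  have "is_trivial l e ((remove_period l e ^^ ?m) (lam, s))"
  proof -
    obtain mu t where "(remove_period l e ^^ ?m) (lam, s) = (mu, t)" "charged_mpart l (mu, t)"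
      "\<And>x c. count e (beads mu t) x c = count e (beads lam s) x c - ?m"
      using it[of ?m] by blast
    then show ?thesis using is_trivial_of_truncated_counts[OF ab dec l e z] by metis
  qed
  then have "\<exists>j. \<not> ?b ((remove_period l e ^^ j) (lam, s))" by blast
  then have "peel l e (lam, s) \<noteq> None"
    unfolding peel_def while_option_def by (subst if_P) simp_all
  then obtain x where x: "peel l e (lam, s) = Some x" by blast
  then obtain j where "x = (remove_period l e ^^ j) (lam, s)"
    using while_option_stop2[of ?b "remove_period l e" "(lam, s)" x] unfolding peel_def by metis
  then obtain mu t where mt: "x = (mu, t)" "charged_mpart l (mu, t)" "decreasing_counts e (beads mu t)"
    using it[of j] by auto
  have "e_periodic l e x"
    using decreasing_counts_imp_bead_period[OF abacus_beads[OF mt(2)] mt(3) l e]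
      e_periodic_iff[OF mt(2) e] mt(1) by blast
  moreover have "\<not> ?b x" using while_option_stop[OF x[unfolded peel_def]] .
  ultimately have "is_trivial l e x" by simp
  with x show "totally_periodic l e lam s" unfolding totally_periodic_def by (intro exI conjI)
next
  assume "totally_periodic l e lam s"
  then obtain x where x: "peel l e (lam, s) = Some x" "is_trivial l e x"
    unfolding totally_periodic_def by (elim exE conjE)
  show "decreasing_counts e (beads lam s)"
  proof (rule ccontr)
    assume nd: "\<not> decreasing_counts e (beads lam s)"
    let ?P = "\<lambda>(mu, t). charged_mpart l (mu, t) \<and> \<not> decreasing_counts e (beads mu t)"
    have "?P x"
    proof (rule while_option_rule[OF _ x(1)[unfolded peel_def]])
      show "?P (lam, s)" using v nd by simp
      fix y assume y: "?P y" "e_periodic l e y \<and> \<not> is_trivial l e y"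
      obtain mu t where mt: "y = (mu, t)" by (cases y)
      then have vm: "charged_mpart l (mu, t)" and nm: "\<not> decreasing_counts e (beads mu t)"
        using y by auto
      obtain k r where per: "bead_period e (beads mu t) k r"
        using y(2) mt e_periodic_iff[OF vm e] by blast
      obtain mu' t' where rem: "remove_period l e (mu, t) = (mu', t')" "charged_mpart l (mu', t')"
        "beads mu' t' = beads mu t - period_beads e k r" using remove_period_beads[OF vm e per] .
      show "?P (remove_period l e y)"
        using rem nm decreasing_counts_remove_period[OF abacus_beads[OF vm] per e] mt by simp
    qed
    moreover obtain mu t where "x = (mu, t)" by (cases x)
    ultimately show False using is_trivial_decreasing_counts[of l mu t e] x(2) by simp
  qed
qed

section \<open>Words in two letters\<close>

text \<open>
  The number of letters \<open>R\<close> that are not yet matched by a later \<open>A\<close>, updated from left to right; at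
  the end this is the exponent \<open>q\<close> of the reduced word \<open>A\<^sup>p R\<^sup>q\<close>.
\<close>
definition scan :: "letter list \<Rightarrow> nat" where
  "scan w = fold (\<lambda>x q. if x = LetR then Suc q else q - 1) w 0"

lemma scan_delete_RA: "delete_RA v w \<Longrightarrow> scan v = scan w"
  by (induction rule: delete_RA.induct) (simp add: scan_def)

lemma scan_deletes: "delete_RA\<^sup>*\<^sup>* v w \<Longrightarrow> scan v = scan w"
  by (induction rule: rtranclp_induct) (auto dest: scan_delete_RA)

lemma scan_normal: "scan (replicate p LetA @ replicate q LetR) = q"
proof -
  have "fold (\<lambda>x q. if x = LetR then Suc q else q - 1) (replicate p LetA) 0 = 0" by (induction p) auto
  moreover have "fold (\<lambda>x q. if x = LetR then Suc q else q - 1) (replicate q LetR) n = n + q" for n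
    by (induction q arbitrary: n) auto
  ultimately show ?thesis by (simp add: scan_def)
qed

lemma no_RA_normal:
  "(\<nexists>u v. w = u @ [LetR, LetA] @ v) \<Longrightarrow> \<exists>p q. w = replicate p LetA @ replicate q LetR"
proof (induction w)
  case (Cons x w)
  have "\<nexists>u v. w = u @ [LetR, LetA] @ v" using Cons.prems by (metis append_Cons)
  then obtain p q where w: "w = replicate p LetA @ replicate q LetR" using Cons.IH by blast
  show ?case
  proof (cases x)
    case LetA
    then show ?thesis using w by (intro exI[of _ "Suc p"] exI[of _ q]) simp
  next
    case LetR
    have "p = 0"
    proof (rule ccontr)
      assume "p \<noteq> 0"
      then obtain p' where "p = Suc p'" by (cases p) auto
      then have "x # w = [] @ [LetR, LetA] @ replicate p' LetA @ replicate q LetR"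
        using LetR w by simp
      then show False using Cons.prems by blast
    qed
    then show ?thesis using w LetR by (intro exI[of _ 0] exI[of _ "Suc q"]) simp
  qed
qed (intro exI[of _ 0], simp)

lemma ex_normal: "\<exists>p q. delete_RA\<^sup>*\<^sup>* w (replicate p LetA @ replicate q LetR)"
proof (induction w rule: length_induct)
  case (1 w)
  show ?case
  proof (cases "\<exists>u v. w = u @ [LetR, LetA] @ v")
    case True
    then obtain u v where w: "w = u @ [LetR, LetA] @ v" by blast
    then have "delete_RA w (u @ v)" by (metis delete_RA.intros)
    moreover obtain p q where "delete_RA\<^sup>*\<^sup>* (u @ v) (replicate p LetA @ replicate q LetR)"
      using 1 w by fastforce
    ultimately show ?thesis by (meson converse_rtranclp_into_rtranclp)
  next
    case False
    then show ?thesis using no_RA_normal[OF False] by (metis rtranclp.rtrancl_refl)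
  qed
qed

lemma epsilon_eq_scan: "epsilon l e s lam i = scan (i_word l e s lam i)"
proof -
  obtain p q where pq: "delete_RA\<^sup>*\<^sup>* (i_word l e s lam i) (replicate p LetA @ replicate q LetR)"
    using ex_normal by blast
  show ?thesis unfolding epsilon_def
  proof (rule the_equality)
    show "\<exists>p. delete_RA\<^sup>*\<^sup>* (i_word l e s lam i) (replicate p LetA @ replicate (scan (i_word l e s lam i)) LetR)"
      using pq scan_deletes[OF pq] scan_normal by metis
  qed (use scan_deletes scan_normal in metis)
qed

text \<open>
  The general bound \<open>n\<close> makes the induction on the last letter work: a final \<open>A\<close> can match one
  pending \<open>R\<close> and so raises the bound, a final \<open>R\<close> stays unmatched and lowers it.
\<close>
lemma scan_le_iff:
  "scan w \<le> n \<longleftrightarrow> (\<forall>u v. w = u @ v \<longrightarrow> count_list v LetR \<le> count_list v LetA + n)"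
proof (induction w arbitrary: n rule: rev_induct)
  case Nil
  show ?case by (simp add: scan_def)
next
  case (snoc x w)
  have suffix: "w @ [x] = u @ v \<longleftrightarrow> v = [] \<and> u = w @ [x] \<or> (\<exists>v'. v = v' @ [x] \<and> w = u @ v')" for u v
    by (cases v rule: rev_cases) auto
  have split: "(\<forall>u v. w @ [x] = u @ v \<longrightarrow> Q v) \<longleftrightarrow> Q [] \<and> (\<forall>u v. w = u @ v \<longrightarrow> Q (v @ [x]))" for Q
    unfolding suffix by blast
  show ?case
  proof (cases x)
    case LetA
    have step: "count_list v LetR \<le> count_list v LetA + Suc n \<longleftrightarrow>
        count_list (v @ [x]) LetR \<le> count_list (v @ [x]) LetA + n" for v
      using LetA by simp
    have "scan (w @ [x]) \<le> n \<longleftrightarrow> scan w \<le> Suc n" using LetA by (auto simp: scan_def)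
    then show ?thesis unfolding split snoc.IH[of "Suc n"] step by simp
  next
    case LetR
    have "scan (w @ [x]) \<le> n \<longleftrightarrow> 0 < n \<and> scan w \<le> n - 1" using LetR by (auto simp: scan_def)
    also have "\<dots> \<longleftrightarrow> 0 < n \<and> (\<forall>u v. w = u @ v \<longrightarrow> count_list v LetR \<le> count_list v LetA + (n - 1))"
      using snoc[of "n - 1"] by simp
    also have "\<dots> \<longleftrightarrow> (\<forall>u v. w = u @ v \<longrightarrow> Suc (count_list v LetR) \<le> count_list v LetA + n)"
    proof
      assume R: "\<forall>u v. w = u @ v \<longrightarrow> Suc (count_list v LetR) \<le> count_list v LetA + n"
      have "0 < n" using R[rule_format, of w "[]"] by simp
      then show "0 < n \<and> (\<forall>u v. w = u @ v \<longrightarrow> count_list v LetR \<le> count_list v LetA + (n - 1))"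
        using R by fastforce
    qed fastforce
    finally show ?thesis unfolding split using LetR by simp
  qed
qed

section \<open>Addable and removable nodes\<close>

lemma in_diagram_iff:
  "c < length lam \<Longrightarrow> (a, b, c) \<in> diagram lam \<longleftrightarrow> b < (lam ! c) a"
  by (simp add: diagram_def)

lemma is_mpart_update:
  assumes lam: "is_mpart l lam" and c: "c < l"
    and up: "\<And>a'. a' < a \<Longrightarrow> n \<le> (lam ! c) a'" and dn: "\<And>a'. a < a' \<Longrightarrow> (lam ! c) a' \<le> n"
  shows "is_mpart l (lam[c := (lam ! c)(a := n)])"
proof -
  have len: "length lam = l" and p: "antimono (lam ! c)" "finite {a. (lam ! c) a \<noteq> 0}"
    using lam c by (auto simp: is_mpart_def is_partition_def)
  have "antimono ((lam ! c)(a := n))"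
  proof (rule antimonoI)
    fix i j :: nat assume "i \<le> j"
    then have "(lam ! c) j \<le> (lam ! c) i" using p(1) by (rule antimonoD[rotated])
    then show "((lam ! c)(a := n)) j \<le> ((lam ! c)(a := n)) i"
      using up[of i] dn[of j] \<open>i \<le> j\<close> by (cases "i = a"; cases "j = a") simp_all
  qed
  moreover have "finite {a'. ((lam ! c)(a := n)) a' \<noteq> 0}"
    by (rule finite_subset[of _ "insert a {a. (lam ! c) a \<noteq> 0}"]) (use p in auto)
  ultimately have "is_partition ((lam ! c)(a := n))" by (simp add: is_partition_def)
  then show ?thesis using lam len c by (simp add: is_mpart_def nth_list_update)
qed

lemma addable_iff:
  assumes lam: "is_mpart l lam"
  shows "addable l lam (a, b, c) \<longleftrightarrow> c < l \<and> b = (lam ! c) a \<and> (\<forall>a'<a. b < (lam ! c) a')"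
proof
  assume "addable l lam (a, b, c)"
  then obtain mu where notin: "(a, b, c) \<notin> diagram lam" and mu: "is_mpart l mu"
    and dg: "diagram mu = insert (a, b, c) (diagram lam)" unfolding addable_def by blast
  have len: "length lam = l" "length mu = l" using lam mu by (auto simp: is_mpart_def)
  have "(a, b, c) \<in> diagram mu" using dg by simp
  then have c: "c < l" and bmu: "b < (mu ! c) a" using len by (simp_all add: diagram_def)
  have row: "b' < (mu ! c) a' \<longleftrightarrow> a' = a \<and> b' = b \<or> b' < (lam ! c) a'" for a' b'
    using in_diagram_iff[of c mu a' b'] in_diagram_iff[of c lam a' b'] dg c len by simp
  have "\<not> b < (lam ! c) a" using notin in_diagram_iff[of c lam a b] c len by simp
  then have "b = (lam ! c) a" using row[of "(lam ! c) a" a] bmu by fastforce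
  moreover have "b < (lam ! c) a'" if "a' < a" for a'
  proof -
    have "antimono (mu ! c)" using mu c by (simp add: is_mpart_def is_partition_def)
    then have "(mu ! c) a \<le> (mu ! c) a'" using that by (simp add: antimonoD)
    then show ?thesis using bmu row[of b a'] that by simp
  qed
  ultimately show "c < l \<and> b = (lam ! c) a \<and> (\<forall>a'<a. b < (lam ! c) a')" using c by blast
next
  assume R: "c < l \<and> b = (lam ! c) a \<and> (\<forall>a'<a. b < (lam ! c) a')"
  let ?mu = "lam[c := (lam ! c)(a := Suc b)]"
  have len: "length lam = l" using lam by (auto simp: is_mpart_def)
  have "antimono (lam ! c)" using lam R by (simp add: is_mpart_def is_partition_def)
  then have "(lam ! c) a' \<le> Suc b" if "a < a'" for a'
    using R that by (simp add: antimonoD le_SucI)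
  then have "is_mpart l ?mu" using R by (intro is_mpart_update[OF lam]) (auto intro: Suc_leI)
  moreover have "diagram ?mu = insert (a, b, c) (diagram lam)"
    using R len by (fastforce simp: diagram_def nth_list_update less_Suc_eq split: if_splits)
  moreover have "(a, b, c) \<notin> diagram lam" using R by (simp add: diagram_def)
  ultimately show "addable l lam (a, b, c)" unfolding addable_def by blast
qed

lemma removable_iff:
  assumes lam: "is_mpart l lam"
  shows "removable l lam (a, b, c) \<longleftrightarrow> c < l \<and> Suc b = (lam ! c) a \<and> (\<forall>a'>a. (lam ! c) a' \<le> b)"
proof
  assume "removable l lam (a, b, c)"
  then obtain mu where isin: "(a, b, c) \<in> diagram lam" and mu: "is_mpart l mu"
    and dg: "diagram mu = diagram lam - {(a, b, c)}" unfolding removable_def by blast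
  have len: "length lam = l" "length mu = l" using lam mu by (auto simp: is_mpart_def)
  have c: "c < l" and blam: "b < (lam ! c) a" using isin len by (simp_all add: diagram_def)
  have row: "b' < (mu ! c) a' \<longleftrightarrow> \<not> (a' = a \<and> b' = b) \<and> b' < (lam ! c) a'" for a' b'
    using in_diagram_iff[of c mu a' b'] in_diagram_iff[of c lam a' b'] dg c len by auto
  have bmu: "\<not> b < (mu ! c) a" using row by simp
  then have "\<not> Suc b < (lam ! c) a" using row[of "Suc b" a] by simp
  then have "Suc b = (lam ! c) a" using blam by simp
  moreover have "(lam ! c) a' \<le> b" if "a < a'" for a'
  proof -
    have "antimono (mu ! c)" using mu c by (simp add: is_mpart_def is_partition_def)
    then have "(mu ! c) a' \<le> (mu ! c) a" using that by (simp add: antimonoD)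
    then have "\<not> b < (mu ! c) a'" using bmu by simp
    then show ?thesis using row[of b a'] that by simp
  qed
  ultimately show "c < l \<and> Suc b = (lam ! c) a \<and> (\<forall>a'>a. (lam ! c) a' \<le> b)" using c by blast
next
  assume R: "c < l \<and> Suc b = (lam ! c) a \<and> (\<forall>a'>a. (lam ! c) a' \<le> b)"
  let ?mu = "lam[c := (lam ! c)(a := b)]"
  have len: "length lam = l" using lam by (auto simp: is_mpart_def)
  have "antimono (lam ! c)" using lam R by (simp add: is_mpart_def is_partition_def)
  then have "b \<le> (lam ! c) a'" if "a' < a" for a'
    using R that antimonoD[of "lam ! c" a' a] by simp
  then have "is_mpart l ?mu" using R by (intro is_mpart_update[OF lam]) auto
  moreover have "diagram ?mu = diagram lam - {(a, b, c)}"
    using R len by (fastforce simp: diagram_def nth_list_update less_Suc_eq split: if_splits)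
  moreover have "(a, b, c) \<in> diagram lam" using R len by (simp add: diagram_def)
  ultimately show "removable l lam (a, b, c)" unfolding removable_def by blast
qed

section \<open>Nodes as places of a symbol\<close>

definition place :: "int list \<Rightarrow> node \<Rightarrow> int \<times> nat" where
  "place s n = (content s n, snd (snd n))"

definition bead_before_gap :: "(int \<times> nat) set \<Rightarrow> (int \<times> nat) set" where
  "bead_before_gap B = {(x, c). (x, c) \<in> B \<and> (x + 1, c) \<notin> B}"

definition gap_before_bead :: "(int \<times> nat) set \<Rightarrow> (int \<times> nat) set" where
  "gap_before_bead B = {(x, c). (x, c) \<notin> B \<and> (x + 1, c) \<in> B}"

text \<open>
  The upper neighbour \<open>x + 1\<close> of an entry \<open>x\<close> is occupied exactly when the preceding part is equal,
  which is what prevents a row of the diagram from growing.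
\<close>
lemma addable_iff_beads:
  assumes v: "charged_mpart l (lam, s)"
  shows "addable l lam (a, b, c) \<longleftrightarrow>
    c < l \<and> content s (a, b, c) = symb lam s c a \<and> (symb lam s c a + 1, c) \<notin> beads lam s"
proof -
  have lam: "is_mpart l lam" using v by (simp add: charged_mpart_def)
  show ?thesis
  proof (cases "c < l \<and> b = (lam ! c) a")
    case True
    then have c: "c < l" and b: "b = (lam ! c) a" by auto
    then have p: "is_partition (lam ! c)" using lam by (simp add: is_mpart_def)
    then have am: "(lam ! c) j \<le> (lam ! c) i" if "i \<le> j" for i j
      using that by (simp add: is_partition_def antimonoD)
    have "(\<forall>a'<a. b < (lam ! c) a') \<longleftrightarrow> (\<nexists>i. symb lam s c i = symb lam s c a + 1)"
    proof
      assume R: "\<forall>a'<a. b < (lam ! c) a'"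
      show "\<nexists>i. symb lam s c i = symb lam s c a + 1"
      proof
        assume "\<exists>i. symb lam s c i = symb lam s c a + 1"
        then obtain i where i: "symb lam s c i = symb lam s c a + 1" by blast
        then show False using R b am[of a i] by (cases "i < a") (force simp: symb_def)+
      qed
    next
      assume R: "\<nexists>i. symb lam s c i = symb lam s c a + 1"
      show "\<forall>a'<a. b < (lam ! c) a'"
      proof (intro allI impI)
        fix a' assume "a' < a"
        then obtain d where d: "a = Suc d" "a' \<le> d" by (cases a) auto
        have "(lam ! c) d \<noteq> (lam ! c) a"
        proof
          assume "(lam ! c) d = (lam ! c) a"
          then have "symb lam s c d = symb lam s c a + 1" using d by (simp add: symb_def)
          then show False using R by blast
        qed
        then show "b < (lam ! c) a'" using am[of d a] am[of a' d] d b by simp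
      qed
    qed
    then show ?thesis unfolding addable_iff[OF lam] in_beads_iff[OF v]
      using True by (simp add: symb_def)
  next
    case False
    then show ?thesis unfolding addable_iff[OF lam] by (auto simp: symb_def)
  qed
qed

text \<open>
  Dually, the lower neighbour of an entry is occupied exactly when the following part is equal.
\<close>
lemma removable_iff_beads:
  assumes v: "charged_mpart l (lam, s)"
  shows "removable l lam (a, b, c) \<longleftrightarrow>
    c < l \<and> content s (a, b, c) + 1 = symb lam s c a \<and> (content s (a, b, c), c) \<notin> beads lam s"
proof -
  have lam: "is_mpart l lam" using v by (simp add: charged_mpart_def)
  show ?thesis
  proof (cases "c < l \<and> Suc b = (lam ! c) a")
    case True
    then have c: "c < l" and b: "Suc b = (lam ! c) a" by auto
    then have p: "is_partition (lam ! c)" using lam by (simp add: is_mpart_def)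
    then have am: "(lam ! c) j \<le> (lam ! c) i" if "i \<le> j" for i j
      using that by (simp add: is_partition_def antimonoD)
    have "(\<forall>a'>a. (lam ! c) a' \<le> b) \<longleftrightarrow> (\<nexists>i. symb lam s c i = symb lam s c a - 1)"
    proof
      assume R: "\<forall>a'>a. (lam ! c) a' \<le> b"
      show "\<nexists>i. symb lam s c i = symb lam s c a - 1"
      proof
        assume "\<exists>i. symb lam s c i = symb lam s c a - 1"
        then obtain i where i: "symb lam s c i = symb lam s c a - 1" by blast
        then show False using R b am[of i a] by (cases "a < i") (force simp: symb_def)+
      qed
    next
      assume R: "\<nexists>i. symb lam s c i = symb lam s c a - 1"
      show "\<forall>a'>a. (lam ! c) a' \<le> b"
      proof (intro allI impI)
        fix a' assume "a < a'"
        have "(lam ! c) (Suc a) \<noteq> (lam ! c) a"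
        proof
          assume "(lam ! c) (Suc a) = (lam ! c) a"
          then have "symb lam s c (Suc a) = symb lam s c a - 1" by (simp add: symb_def)
          then show False using R by blast
        qed
        then show "(lam ! c) a' \<le> b" using am[of a "Suc a"] am[of "Suc a" a'] \<open>a < a'\<close> b by simp
      qed
    qed
    moreover have "content s (a, b, c) = symb lam s c a - 1" using b by (simp add: symb_def)
    ultimately show ?thesis unfolding removable_iff[OF lam] in_beads_iff[OF v]
      using True by simp
  next
    case False
    then show ?thesis unfolding removable_iff[OF lam] by (auto simp: symb_def)
  qed
qed

lemma bij_betw_addable:
  assumes v: "charged_mpart l (lam, s)"
  shows "bij_betw (place s) {n. addable l lam n} (bead_before_gap (beads lam s))"
proof (rule bij_betw_imageI)
  show "inj_on (place s) {n. addable l lam n}"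
  proof (rule inj_onI, clarsimp)
    fix a b c a' b' c'
    assume "addable l lam (a, b, c)" "addable l lam (a', b', c')"
      and eq: "place s (a, b, c) = place s (a', b', c')"
    then have "c < l" "symb lam s c a = symb lam s c a'"
      unfolding addable_iff_beads[OF v] place_def by auto
    then show "a = a' \<and> b = b' \<and> c = c'" using symb_inject[OF v] eq by (auto simp: place_def)
  qed
  show "place s ` {n. addable l lam n} = bead_before_gap (beads lam s)"
  proof (intro equalityI subsetI)
    fix y assume "y \<in> place s ` {n. addable l lam n}"
    then obtain a b c where "y = place s (a, b, c)" "addable l lam (a, b, c)" by auto
    then show "y \<in> bead_before_gap (beads lam s)"
      unfolding addable_iff_beads[OF v] place_def bead_before_gap_def
      using symb_in_beads[OF v, of c a] by simp
  next
    fix y assume "y \<in> bead_before_gap (beads lam s)"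
    then obtain x c where y: "y = (x, c)" "(x, c) \<in> beads lam s" "(x + 1, c) \<notin> beads lam s"
      by (auto simp: bead_before_gap_def)
    obtain a where a: "c < l" "symb lam s c a = x" using in_beadsE[OF v y(2)] .
    have ct: "content s (a, (lam ! c) a, c) = symb lam s c a" by (simp add: symb_def)
    have "addable l lam (a, (lam ! c) a, c)"
      unfolding addable_iff_beads[OF v] ct using a y by simp
    then show "y \<in> place s ` {n. addable l lam n}"
      using y(1) a ct by (intro image_eqI[of _ _ "(a, (lam ! c) a, c)"]) (simp_all add: place_def)
  qed
qed

lemma bij_betw_removable:
  assumes v: "charged_mpart l (lam, s)"
  shows "bij_betw (place s) {n. removable l lam n} (gap_before_bead (beads lam s))"
proof (rule bij_betw_imageI)
  show "inj_on (place s) {n. removable l lam n}"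
  proof (rule inj_onI, clarsimp)
    fix a b c a' b' c'
    assume "removable l lam (a, b, c)" "removable l lam (a', b', c')"
      and eq: "place s (a, b, c) = place s (a', b', c')"
    then have "c < l" "symb lam s c a = symb lam s c a'"
      unfolding removable_iff_beads[OF v] place_def by auto
    then show "a = a' \<and> b = b' \<and> c = c'" using symb_inject[OF v] eq by (auto simp: place_def)
  qed
  show "place s ` {n. removable l lam n} = gap_before_bead (beads lam s)"
  proof (intro equalityI subsetI)
    fix y assume "y \<in> place s ` {n. removable l lam n}"
    then obtain a b c where "y = place s (a, b, c)" "removable l lam (a, b, c)" by auto
    then show "y \<in> gap_before_bead (beads lam s)"
      unfolding removable_iff_beads[OF v] place_def gap_before_bead_def
      using symb_in_beads[OF v, of c a] by simp
  next
    fix y assume "y \<in> gap_before_bead (beads lam s)"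
    then obtain x c where y: "y = (x, c)" "(x, c) \<notin> beads lam s" "(x + 1, c) \<in> beads lam s"
      by (auto simp: gap_before_bead_def)
    obtain a where a: "c < l" "symb lam s c a = x + 1" using in_beadsE[OF v y(3)] .
    \<comment> \<open>An entry of an empty part has its lower neighbour occupied by the next part.\<close>
    have "(lam ! c) a \<noteq> 0"
    proof
      assume "(lam ! c) a = 0"
      moreover have "antimono (lam ! c)"
        using v a by (simp add: charged_mpart_def is_mpart_def is_partition_def)
      then have "(lam ! c) (Suc a) \<le> (lam ! c) a" by (simp add: antimonoD)
      ultimately have "symb lam s c (Suc a) = x" using a by (simp add: symb_def)
      then show False using y(2) a(1) in_beads_iff[OF v] by blast
    qed
    then obtain b where b: "(lam ! c) a = Suc b" by (cases "(lam ! c) a") auto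
    have ct: "content s (a, b, c) = x" using a b by (simp add: symb_def)
    have "removable l lam (a, b, c)"
      unfolding removable_iff_beads[OF v] ct using a y by simp
    then show "y \<in> place s ` {n. removable l lam n}"
      using y(1) ct by (intro image_eqI[of _ _ "(a, b, c)"]) (simp_all add: place_def)
  qed
qed

lemma card_places:
  assumes "bij_betw (place s) {n. P n} Y"
  shows "card {n. P n \<and> place s n \<in> U} = card (Y \<inter> U)"
proof -
  have "place s ` {n. P n \<and> place s n \<in> U} = Y \<inter> U"
    using assms by (auto simp: bij_betw_def)
  moreover have "inj_on (place s) {n. P n \<and> place s n \<in> U}"
    using assms by (auto simp: bij_betw_def inj_on_def)
  ultimately show ?thesis using card_image by fastforce
qed

lemma count_shift:
  "count e B (x + 1) c = card ({(y, d). (y + 1, d) \<in> B} \<inter> above e x c)"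
proof -
  have "bij_betw (\<lambda>(y, d). (y + 1, d)) ({(y, d). (y + 1, d) \<in> B} \<inter> above e x c) (B \<inter> above e (x + 1) c)"
    by (rule bij_betw_byWitness[where f' = "\<lambda>(y, d). (y - 1, d)"]) (auto simp: above_def algebra_simps)
  then show ?thesis unfolding count_def using bij_betw_same_card by metis
qed

text \<open>
  Shifted by one, the beads counted at \<open>x + 1\<close> lie over the same places as those counted at \<open>x\<close>; the
  common places cancel and what remains are the removable and the addable ones.
\<close>
lemma count_le_iff_gaps:
  assumes ab: "abacus l B"
  shows "count e B (x + 1) c \<le> count e B x c \<longleftrightarrow>
    card (gap_before_bead B \<inter> above e x c) \<le> card (bead_before_gap B \<inter> above e x c)"
proof -
  let ?X = "B \<inter> above e x c" and ?Y = "{(y, d). (y + 1, d) \<in> B} \<inter> above e x c"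
  have fX: "finite ?X" by (rule finite_above[OF ab])
  have "(\<lambda>(y, d). (y + 1, d)) ` ?Y \<subseteq> B \<inter> above e (x + 1) c" by (auto simp: above_def algebra_simps)
  then have "finite ((\<lambda>(y, d). (y + 1, d)) ` ?Y)" using finite_above[OF ab] finite_subset by blast
  then have fY: "finite ?Y" by (rule finite_imageD) (auto simp: inj_on_def)
  have "bead_before_gap B \<inter> above e x c = ?X - ?Y" "gap_before_bead B \<inter> above e x c = ?Y - ?X"
    by (auto simp: bead_before_gap_def gap_before_bead_def)
  moreover have "card ?X = card (?X \<inter> ?Y) + card (?X - ?Y)" "card ?Y = card (?Y \<inter> ?X) + card (?Y - ?X)"
    using card_Int_Diff[OF fX] card_Int_Diff[OF fY] by blast+
  ultimately show ?thesis unfolding count_shift by (simp add: count_def Int_commute)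
qed

text \<open>
  Gaps next to beads occur only between the full part of the rows and the largest bead.
\<close>
lemma finite_bead_gap:
  assumes ab: "abacus l B"
  shows "finite (bead_before_gap B \<union> gap_before_bead B)"
proof -
  obtain K M where rows: "snd ` B \<subseteq> {..<l}" and K: "\<forall>b\<in>B. fst b \<le> K" and M: "{..M} \<times> {..<l} \<subseteq> B"
    using ab unfolding abacus_def by blast
  have "(x, c) \<in> {M - 1..K} \<times> {..<l}" if x: "(x, c) \<in> bead_before_gap B \<union> gap_before_bead B" for x c
  proof -
    have *: "(x, c) \<in> B \<or> (x + 1, c) \<in> B" "(x, c) \<notin> B \<or> (x + 1, c) \<notin> B"
      using x by (auto simp: bead_before_gap_def gap_before_bead_def)
    have c: "c < l" using *(1) rows by force
    have "x \<le> K" using *(1) K by force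
    moreover have "\<not> x + 1 \<le> M"
    proof
      assume "x + 1 \<le> M"
      then have "(x, c) \<in> B" "(x + 1, c) \<in> B" using M c by auto
      then show False using *(2) by blast
    qed
    ultimately show ?thesis using c by simp
  qed
  then have "bead_before_gap B \<union> gap_before_bead B \<subseteq> {M - 1..K} \<times> {..<l}" by (rule subrelI)
  then show ?thesis by (rule finite_subset) auto
qed

section \<open>The word of a residue\<close>

lemma ex_sorted_wrt:
  assumes "finite S" "transp R" "totalp_on S R"
  shows "\<exists>xs. set xs = S \<and> sorted_wrt R xs"
  using assms(1,3)
proof (induction S rule: finite_psubset_induct)
  case (psubset S)
  show ?case
  proof (cases "S = {}")
    case False
    have "transp_on S R" using assms(2) transp_on_subset by blast
    then obtain m where m: "m \<in> S" and least: "\<forall>y\<in>S. y \<noteq> m \<longrightarrow> R m y"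
      using Finite_Set.bex_least_element[OF psubset.hyps False _ psubset.prems] by blast
    have "totalp_on (S - {m}) R" using psubset.prems by (rule totalp_on_subset) blast
    then obtain xs where xs: "set xs = S - {m}" "sorted_wrt R xs"
      using psubset.IH[of "S - {m}"] m by blast
    have "set (m # xs) = S" "sorted_wrt R (m # xs)" using xs m least by auto
    then show ?thesis by blast
  qed simp
qed

lemma sorted_wrt_unique:
  assumes "asymp R" "sorted_wrt R xs" "sorted_wrt R ys" "set xs = set ys"
  shows "xs = ys"
  using assms(2-)
proof (induction xs arbitrary: ys)
  case (Cons x xs)
  then obtain y zs where y: "ys = y # zs" by (cases ys) auto
  have R: "\<And>z. z \<in> set xs \<Longrightarrow> R x z" "\<And>z. z \<in> set zs \<Longrightarrow> R y z"
    and eq: "insert x (set xs) = insert y (set zs)" using Cons.prems y by auto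
  have asym: "R u v \<Longrightarrow> \<not> R v u" for u v using assms(1) by (rule asympD)
  have "x = y"
  proof (rule ccontr)
    assume "x \<noteq> y"
    then have "y \<in> set xs" "x \<in> set zs" using eq insertI1[of y "set zs"] insertI1[of x "set xs"] by auto
    then show False using asym[OF R(1)[of y]] R(2)[of x] by simp
  qed
  moreover have "x \<notin> set xs" "y \<notin> set zs" using R(1)[of x] R(2)[of y] asym[of x x] asym[of y y] by auto
  ultimately have "set xs = set zs" using eq by (simp add: insert_ident)
  then show ?case using Cons.IH[of zs] Cons.prems y \<open>x = y\<close> by simp
qed simp

lemma sorted_wrt_filter_suffix:
  assumes "sorted_wrt R xs" and "\<And>x y. x \<in> set xs \<Longrightarrow> y \<in> set xs \<Longrightarrow> P x \<Longrightarrow> R x y \<Longrightarrow> P y"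
  shows "\<exists>us. xs = us @ filter P xs"
  using assms
proof (induction xs)
  case (Cons x xs)
  show ?case
  proof (cases "P x")
    case True
    then have "\<forall>y\<in>set xs. P y" using Cons.prems by auto
    then have "filter P (x # xs) = x # xs" using True by simp
    then show ?thesis by (intro exI[of _ "[]"]) simp
  next
    case False
    have "\<exists>us. xs = us @ filter P xs"
    proof (rule Cons.IH)
      show "sorted_wrt R xs" using Cons.prems(1) by simp
      show "P y" if "z \<in> set xs" "y \<in> set xs" "P z" "R z y" for z y
        using Cons.prems(2)[of z y] that by simp
    qed
    then obtain us where "xs = us @ filter P xs" by blast
    then show ?thesis using False by (intro exI[of _ "x # us"]) simp
  qed
qed simp

lemma node_less_above:
  assumes "node_less s m n \<or> m = n" "place s m \<in> above e x c" "int e dvd content s n - x"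
  shows "place s n \<in> above e x c"
  using assms by (auto simp: node_less_def place_def above_def)

lemma i_nodes_spec:
  assumes v: "charged_mpart l (lam, s)"
  shows "set (i_nodes l e s lam i) = {n. (addable l lam n \<or> removable l lam n) \<and> residue e s n = i}"
    and "sorted_wrt (node_less s) (i_nodes l e s lam i)"
proof -
  let ?B = "beads lam s"
  let ?S = "{n. (addable l lam n \<or> removable l lam n) \<and> residue e s n = i}"
  note add = bij_betw_addable[OF v] and rem = bij_betw_removable[OF v]
  have "finite (bead_before_gap ?B)" "finite (gap_before_bead ?B)"
    using finite_bead_gap[OF abacus_beads[OF v]] by auto
  then have "finite {n. addable l lam n}" "finite {n. removable l lam n}"
    using bij_betw_finite[OF add] bij_betw_finite[OF rem] by auto
  then have "finite ({n. addable l lam n} \<union> {n. removable l lam n})" by simp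
  then have fin: "finite ?S" by (rule rev_finite_subset) auto
  have disj: "place s m \<noteq> place s n" if "addable l lam m" "removable l lam n" for m n
  proof -
    have "place s m \<in> bead_before_gap ?B" "place s n \<in> gap_before_bead ?B"
      using that add rem by (auto simp: bij_betw_def)
    then show ?thesis by (auto simp: bead_before_gap_def gap_before_bead_def)
  qed
  have inj: "m = n" if "m \<in> ?S" "n \<in> ?S" "place s m = place s n" for m n
  proof -
    have "addable l lam m \<and> addable l lam n \<or> removable l lam m \<and> removable l lam n"
      using that disj[of m n] disj[of n m] by auto
    then show ?thesis using add rem that(3) unfolding bij_betw_def inj_on_def by blast
  qed
  have "totalp_on ?S (node_less s)"
  proof (rule totalp_onI)
    fix m n assume mn: "m \<in> ?S" "n \<in> ?S" "m \<noteq> n"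
    then have "content s m \<noteq> content s n \<or> snd (snd m) \<noteq> snd (snd n)"
      using inj[OF mn(1,2)] by (auto simp: place_def)
    then show "node_less s m n \<or> node_less s n m" by (auto simp: node_less_def)
  qed
  moreover have "transp (node_less s)" by (rule transpI) (auto simp: node_less_def)
  ultimately obtain xs where xs: "set xs = ?S" "sorted_wrt (node_less s) xs"
    using ex_sorted_wrt[OF fin] by blast
  have asym: "asymp (node_less s)" by (rule asympI) (auto simp: node_less_def)
  have "i_nodes l e s lam i = xs"
    unfolding i_nodes_def
  proof (rule the_equality)
    show "set xs = ?S \<and> sorted_wrt (node_less s) xs" using xs by (rule conjI)
    show "ys = xs" if "set ys = ?S \<and> sorted_wrt (node_less s) ys" for ys
      using sorted_wrt_unique[OF asym _ xs(2), of ys] that xs(1) by simp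
  qed
  then show "set (i_nodes l e s lam i) = ?S"
    and "sorted_wrt (node_less s) (i_nodes l e s lam i)" using xs by simp_all
qed

lemma count_list_letters:
  assumes "distinct vs"
  shows "count_list (map (\<lambda>x. if P x then LetA else LetR) vs) LetA = card {n\<in>set vs. P n}"
    and "count_list (map (\<lambda>x. if P x then LetA else LetR) vs) LetR = card {n\<in>set vs. \<not> P n}"
proof -
  have "count_list (map (\<lambda>x. if P x then LetA else LetR) vs) LetA = length (filter P vs)"
    "count_list (map (\<lambda>x. if P x then LetA else LetR) vs) LetR = length (filter (\<lambda>n. \<not> P n) vs)"
    by (induction vs) auto
  then show "count_list (map (\<lambda>x. if P x then LetA else LetR) vs) LetA = card {n\<in>set vs. P n}"
    and "count_list (map (\<lambda>x. if P x then LetA else LetR) vs) LetR = card {n\<in>set vs. \<not> P n}"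
    using distinct_length_filter[OF assms] by (simp_all add: Collect_conj_eq Int_commute)
qed

text \<open>
  Every nonempty suffix of the list of \<open>i\<close>-nodes consists of the nodes placed in some \<open>above e x c\<close>: take
  the first node of the suffix for the place, with row bound one larger so that it is included.
  Conversely, every set \<open>above e x c\<close> of the right residue cuts off a suffix.
\<close>
lemma epsilon_eq_0_iff:
  assumes v: "charged_mpart l (lam, s)"
  shows "epsilon l e s lam i = 0 \<longleftrightarrow>
    (\<forall>x c. x mod int e = i \<longrightarrow> count e (beads lam s) (x + 1) c \<le> count e (beads lam s) x c)"
proof -
  let ?B = "beads lam s" and ?xs = "i_nodes l e s lam i" and ?L = "\<lambda>n. if addable l lam n then LetA else LetR"
  note spec = i_nodes_spec[OF v, of e i]
  note ab = abacus_beads[OF v]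
  have "distinct xs" if "sorted_wrt (node_less s) xs" for xs
    using that by (induction xs) (auto simp: node_less_def)
  then have dist: "distinct ?xs" using spec(2) .
  have excl: "\<not> addable l lam n" if "removable l lam n" for n
    using that by (auto simp: addable_def removable_def)
  have suffix_iff: "count_list (map ?L vs) LetR \<le> count_list (map ?L vs) LetA \<longleftrightarrow>
      count e ?B (x + 1) c \<le> count e ?B x c"
    if vs: "set vs = {n\<in>set ?xs. place s n \<in> above e x c}" "distinct vs" and x: "x mod int e = i"
    for vs x c
  proof -
    have res: "residue e s n = i" if "place s n \<in> above e x c" for n
      using that x by (auto simp: place_def above_def residue_def mod_eq_dvd_iff)
    have "{n\<in>set vs. addable l lam n} = {n. addable l lam n \<and> place s n \<in> above e x c}"
      "{n\<in>set vs. \<not> addable l lam n} = {n. removable l lam n \<and> place s n \<in> above e x c}"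
      using vs(1) spec(1) excl res by auto
    then show ?thesis
      using count_list_letters[OF vs(2), of "addable l lam"] count_le_iff_gaps[OF ab, of e x c]
        card_places[OF bij_betw_addable[OF v]] card_places[OF bij_betw_removable[OF v]] by simp
  qed
  have dv: "int e dvd content s n - x" if "n \<in> set ?xs" "x mod int e = i" for n x
    using that spec(1) by (auto simp: residue_def mod_eq_dvd_iff)
  have "epsilon l e s lam i = 0 \<longleftrightarrow>
     (\<forall>u w. map ?L ?xs = u @ w \<longrightarrow> count_list w LetR \<le> count_list w LetA)"
    unfolding epsilon_eq_scan i_word_def using scan_le_iff[of "map ?L ?xs" 0] by simp
  also have "\<dots> \<longleftrightarrow> (\<forall>us vs. ?xs = us @ vs \<longrightarrow> count_list (map ?L vs) LetR \<le> count_list (map ?L vs) LetA)"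
    unfolding map_eq_append_conv by blast
  also have "\<dots> \<longleftrightarrow> (\<forall>x c. x mod int e = i \<longrightarrow> count e ?B (x + 1) c \<le> count e ?B x c)"
  proof (intro iffI allI impI)
    fix x c
    assume suf: "\<forall>us vs. ?xs = us @ vs \<longrightarrow> count_list (map ?L vs) LetR \<le> count_list (map ?L vs) LetA"
      and x: "x mod int e = i"
    let ?vs = "filter (\<lambda>n. place s n \<in> above e x c) ?xs"
    have "\<exists>us. ?xs = us @ ?vs"
    proof (rule sorted_wrt_filter_suffix[OF spec(2)])
      fix m n assume "n \<in> set ?xs" "place s m \<in> above e x c" "node_less s m n"
      then show "place s n \<in> above e x c"
        using node_less_above[of s m n e x c] dv[of n x] x by simp
    qed
    then have "count_list (map ?L ?vs) LetR \<le> count_list (map ?L ?vs) LetA" using suf by blast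
    then show "count e ?B (x + 1) c \<le> count e ?B x c"
      using suffix_iff[of ?vs x c] dist x by simp
  next
    fix us vs
    assume dec: "\<forall>x c. x mod int e = i \<longrightarrow> count e ?B (x + 1) c \<le> count e ?B x c"
      and xs: "?xs = us @ vs"
    show "count_list (map ?L vs) LetR \<le> count_list (map ?L vs) LetA"
    proof (cases vs)
      case (Cons v ws)
      let ?x = "content s v" and ?c = "Suc (snd (snd v))"
      have v_in: "v \<in> set ?xs" using xs Cons by simp
      then have x: "?x mod int e = i" using spec(1) by (simp add: residue_def)
      have pv: "place s v \<in> above e ?x ?c" by (simp add: place_def above_def)
      have sorted: "\<And>m. m \<in> set us \<Longrightarrow> node_less s m v" "\<And>n. n \<in> set ws \<Longrightarrow> node_less s v n"
        using spec(2) xs Cons by (auto simp: sorted_wrt_append)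
      have "place s m \<notin> above e ?x ?c" if "m \<in> set us" for m
        using sorted(1)[OF that] by (auto simp: place_def above_def node_less_def)
      moreover have "place s n \<in> above e ?x ?c" if "n \<in> set vs" for n
        using node_less_above[OF _ pv, of n] sorted(2)[of n] dv[of n ?x] x that xs Cons by auto
      ultimately have "set vs = {n\<in>set ?xs. place s n \<in> above e ?x ?c}" using xs by auto
      moreover have "distinct vs" using dist xs by simp
      ultimately show ?thesis using suffix_iff[of vs ?x ?c] dec x by simp
    qed simp
  qed
  finally show ?thesis .
qed

section \<open>Highest weight vertices and total periodicity\<close>

lemma highest_weight_vertex_iff:
  assumes v: "charged_mpart l (lam, s)" and e: "0 < e"
  shows "highest_weight_vertex l e s lam \<longleftrightarrow> decreasing_counts e (beads lam s)"
proof -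
  have "highest_weight_vertex l e s lam \<longleftrightarrow> (\<forall>i\<in>{0..<int e}. \<forall>x c. x mod int e = i \<longrightarrow>
      count e (beads lam s) (x + 1) c \<le> count e (beads lam s) x c)"
    unfolding highest_weight_vertex_def epsilon_eq_0_iff[OF v] by (rule refl)
  also have "\<dots> \<longleftrightarrow> decreasing_counts e (beads lam s)"
    unfolding decreasing_counts_def
  proof (intro iffI allI ballI impI)
    fix x c
    assume R: "\<forall>i\<in>{0..<int e}. \<forall>x c. x mod int e = i \<longrightarrow>
      count e (beads lam s) (x + 1) c \<le> count e (beads lam s) x c"
    have "x mod int e \<in> {0..<int e}" using e by simp
    from R[rule_format, OF this refl] show "count e (beads lam s) (x + 1) c \<le> count e (beads lam s) x c" .
  qed simp
  finally show ?thesis .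
qed

theorem theorem5p9:
  fixes l e n :: nat and s :: "int list" and lam :: mpart
  assumes "l \<ge> 1" and "e \<ge> 2"
    and "length s = l"
    and "mpart_of l n lam"
  shows "highest_weight_vertex l e s lam \<longleftrightarrow> totally_periodic l e lam s"
proof -
  have v: "charged_mpart l (lam, s)" using assms by (simp add: charged_mpart_def mpart_of_def)
  show ?thesis
    using highest_weight_vertex_iff[OF v] decreasing_counts_iff_totally_periodic[OF v] assms by simp
qed

end
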